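(* Let $G\in M_n(\mathbb{R})$ have a positive definite symmetric part $\frac12(G+G^T)$ (so that $G$ is invertible), and let $Q:=-G^{-1}$. If there exists a $1$-permanental vector $\ell$ with kernel $G$, then $\ell$ has a density $\rho$ with respect to Lebesgue measure on $\mathbb{R}_+^n$, which can be represented as $$\rho(l)=\int_{(0,2\pi)^n}\frac{1}{(2\pi)^n|G|}\,\exp\Big(\sum_{i,j=1}^n Q_{ij}\sqrt{l_il_j}\,e^{\mathrm{i}(\theta_i-\theta_j)}\Big)\,d\theta ,\qquad l=(l_1,\dots,l_n)\in\mathbb{R}_+^n,$$ where $d\theta=\prod_i d\theta_i$ and $\mathrm{i}=\sqrt{-1}$ in the exponent.
   Context: $M_n(\mathbb{R})$ is the set of real $n\times n$ matrices; $|A|$ denotes the determinant of a square matrix $A$. $\mathbb{R}_+=[0,\infty)$. For $\alpha>0$, a random vector $\ell\in\mathbb{R}_+^n$ is called an $\alpha$-permanental vector with kernel $G\in M_n(\mathbb{R})$ if for every $\lambda\in\mathbb{R}_+^n$, $\mathbb{E}[e^{-\langle\lambda,\ell\rangle}]=|I+\Lambda G|^{-\alpha}$, where $\Lambda=\mathrm{diag}(\lambda_1,\dots,\lambda_n)$. *)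

theory Defs
  imports "HOL-Probability.Probability"
begin

definition nonneg_orthant :: "(real ^ 'n) set" where
  "nonneg_orthant = {x. \<forall>i. 0 \<le> x $ i}"

definition diag_mat :: "real ^ 'n \<Rightarrow> real ^ 'n ^ 'n" where
  "diag_mat v = (\<chi> i j. if i = j then v $ i else 0)"

definition symmetric_part :: "real ^ 'n ^ 'n \<Rightarrow> real ^ 'n ^ 'n" where
  "symmetric_part A = (1 / 2) *\<^sub>R (A + transpose A)"

definition positive_definite :: "real ^ 'n ^ 'n \<Rightarrow> bool" where
  "positive_definite A \<longleftrightarrow> transpose A = A \<and> (\<forall>x. x \<noteq> 0 \<longrightarrow> 0 < x \<bullet> (A *v x))"

(* The defining identity forces det (I + diag v ** G) > 0 on the whole orthant, so that powr
   is a genuine real power there: the left-hand side is nonzero whereas 0 powr _ = 0, so the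
   determinant does not vanish; it is continuous in v and equals 1 at v = 0. *)
definition permanental_vector ::
    "real \<Rightarrow> real ^ 'n ^ 'n \<Rightarrow> 'a measure \<Rightarrow> ('a \<Rightarrow> real ^ 'n) \<Rightarrow> bool" where
  "permanental_vector \<alpha> G M X \<longleftrightarrow>
     0 < \<alpha> \<and> prob_space M \<and> X \<in> measurable M (restrict_space borel nonneg_orthant) \<and>
     (\<forall>v\<in>nonneg_orthant.
        (LINT \<omega>|M. exp (- (v \<bullet> X \<omega>))) = det (mat 1 + diag_mat v ** G) powr (- \<alpha>))"

end

theory Submission
  imports Defs
begin

text \<open>
  Put \<open>W = G\<^sup>-\<^sup>1\<close> and \<open>z\<^sub>j = sqrt l\<^sub>j e\<^bsup>\<i>\<theta>\<^sub>j\<^esup>\<close>; the exponent is \<open>- \<Sum> W\<^sub>j\<^sub>k z\<^sub>j cnj z\<^sub>k\<close>. In polar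
  coordinates the Laplace transform at \<open>\<lambda>\<close> of the claimed density is therefore, up to constants, the
  complex Gaussian integral of \<open>exp (- \<Sum> (W + \<Lambda>)\<^sub>j\<^sub>k z\<^sub>j cnj z\<^sub>k)\<close>, and it equals
  \<open>1 / (det G det (W + \<Lambda>)) = 1 / det (I + \<Lambda> G)\<close>. Laplace transforms determine finite measures on the
  orthant, even when one of the two is a priori signed, so the law of \<open>\<ell>\<close> has this density; being
  continuous, it is nonnegative on all of the orthant.
\<close>

section \<open>Products of Lebesgue measures\<close>

text \<open>The kernel is in general not symmetric, so the Gaussian integral cannot be reduced to a
  diagonal one. What survives is positivity of the quadratic form: \<open>W\<close> inherits it from
  \<open>G\<close>, adding \<open>\<Lambda>\<close> keeps it, and a real congruence turns the
  symmetric part into the identity. The skew part then enters only as a phase, and half of the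
  integration is a Fourier transform. Using the squared moduli \<open>l\<close> as polar variables
  makes the Jacobian the constant 1/2 in each plane; together with one \<open>pi\<close> per plane
  from the Gaussian integral this is the origin of \<open>(2 * pi) ^ CARD('n)\<close>. Nothing in
  the formula shows that the density is nonnegative; only its realness is visible, from the
  reflection of every angle at \<open>pi\<close>. The sign comes from the assumed existence of the
  vector, which is why uniqueness has to admit a signed density. Uniqueness is treated as a moment
  problem: \<open>u = exp (- x)\<close> maps the orthant into the unit cube, where Laplace
  transforms at integer points are moments and polynomials are dense.\<close>

lemma Basis_cart_eq_range: "(Basis :: (real^'n) set) = range (\<lambda>i. axis i 1)"
  by (auto simp: Basis_vec_def)

lemma inj_axis_1: "inj (\<lambda>i. axis i (1::real) :: real^'n)"
  by (auto simp: inj_on_def axis_eq_axis)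

lemma prod_Basis_cart:
  fixes f :: "real^'n \<Rightarrow> 'b::comm_monoid_mult"
  shows "(\<Prod>b\<in>Basis. f b) = (\<Prod>i\<in>UNIV. f (axis i 1))"
  unfolding Basis_cart_eq_range by (subst prod.reindex[OF inj_axis_1]) simp

lemma prod_Basis_prod:
  fixes f :: "'a::euclidean_space \<times> 'b::euclidean_space \<Rightarrow> 'c::comm_monoid_mult"
  shows "(\<Prod>b\<in>Basis. f b) = (\<Prod>b\<in>Basis. f (b, 0)) * (\<Prod>b\<in>Basis. f (0, b))"
  unfolding Basis_prod_def
  by (subst prod.union_disjoint) (auto simp: prod.reindex inj_on_def nonzero_Basis)

lemma borel_measurable_vec_lambda [measurable (raw)]:
  fixes f :: "'a \<Rightarrow> 'n::finite \<Rightarrow> real"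
  assumes "\<And>i. (\<lambda>x. f x i) \<in> borel_measurable M"
  shows "(\<lambda>x. \<chi> i. f x i) \<in> borel_measurable M"
  using assms by (subst borel_measurable_euclidean_space) (auto simp: Basis_cart_eq_range inner_axis)

lemma borel_measurable_vec_nth [measurable (raw)]:
  fixes f :: "'a \<Rightarrow> real ^ 'n"
  assumes "f \<in> borel_measurable M"
  shows "(\<lambda>x. f x $ i) \<in> borel_measurable M"
  by (rule borel_measurable_continuous_on[OF _ assms]) (intro continuous_intros)

text \<open>By \<open>lborel_eqI\<close> it suffices to compare boxes, where both measures multiply
  the side lengths. This carries the product theorems for \<open>PiM\<close> over to
  \<open>real^'n\<close>.\<close>

lemma lborel_vec_eq_distr_PiM:
  "(lborel :: (real^'n) measure) = distr (PiM UNIV (\<lambda>_. lborel)) borel vec_lambda"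
proof (rule lborel_eqI)
  interpret product_sigma_finite "\<lambda>_ :: 'n. lborel :: real measure"
    by standard
  have [measurable]: "vec_lambda \<in> PiM UNIV (\<lambda>_. lborel) \<rightarrow>\<^sub>M (borel :: (real^'n) measure)"
    by measurable
  fix l u :: "real^'n" assume le: "\<And>b. b \<in> Basis \<Longrightarrow> l \<bullet> b \<le> u \<bullet> b"
  have "vec_lambda -` box l u = PiE UNIV (\<lambda>i. box (l $ i) (u $ i))"
    by (auto simp: mem_box_cart PiE_iff)
  then have "emeasure (distr (PiM UNIV (\<lambda>_. lborel)) borel vec_lambda) (box l u) =
      emeasure (PiM UNIV (\<lambda>_. lborel)) (PiE UNIV (\<lambda>i. box (l $ i) (u $ i)))"
    by (subst emeasure_distr) (auto simp: space_PiM)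
  also have "\<dots> = (\<Prod>i\<in>UNIV. emeasure lborel (box (l $ i) (u $ i)))"
    by (rule emeasure_PiM) auto
  also have "\<dots> = (\<Prod>i\<in>UNIV. ennreal (u $ i - l $ i))"
    using le[of "axis _ 1"] by (intro prod.cong) (simp_all add: inner_axis)
  also have "\<dots> = (\<Prod>b\<in>Basis. (u - l) \<bullet> b)"
    using le[of "axis _ 1"] by (simp add: prod_Basis_cart inner_axis prod_ennreal)
  finally show "emeasure (distr (PiM UNIV (\<lambda>_. lborel)) borel vec_lambda) (box l u) =
      (\<Prod>b\<in>Basis. (u - l) \<bullet> b)" .
qed simp

lemma measurable_vec_lambda_pair:
  "(\<lambda>f. (\<chi> i. fst (f i), \<chi> i. snd (f i))) \<in>
     PiM UNIV (\<lambda>_. lborel :: (real \<times> real) measure) \<rightarrow>\<^sub>M (borel :: ((real^'n) \<times> (real^'n)) measure)"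
proof -
  have *: "(\<lambda>f. f i) \<in> PiM UNIV (\<lambda>_. lborel :: (real \<times> real) measure) \<rightarrow>\<^sub>M borel" for i :: 'n
    by measurable
  have "(\<lambda>f. fst (f i)) \<in> borel_measurable (PiM UNIV (\<lambda>_. lborel :: (real \<times> real) measure))"
    "(\<lambda>f. snd (f i)) \<in> borel_measurable (PiM UNIV (\<lambda>_. lborel :: (real \<times> real) measure))" for i :: 'n
    by (rule borel_measurable_continuous_on[OF _ *], intro continuous_intros)+
  then show ?thesis
    by (intro borel_measurable_Pair borel_measurable_vec_lambda)
qed

text \<open>Coordinates are regrouped by index into planes \<open>(x $ i, y $ i)\<close>. This views
  complex n-space as a product of complex planes, so that planar polar coordinates can be used in
  each factor.\<close>

lemma lborel_vec_prod_eq_distr_PiM: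
  "(lborel :: ((real^'n) \<times> (real^'n)) measure) =
     distr (PiM UNIV (\<lambda>_. lborel)) borel (\<lambda>f. (\<chi> i. fst (f i), \<chi> i. snd (f i)))"
  (is "_ = distr ?P borel ?h")
proof (rule lborel_eqI)
  interpret product_sigma_finite "\<lambda>_ :: 'n. lborel :: (real \<times> real) measure"
    by standard
  note measurable_vec_lambda_pair[measurable]
  fix l u :: "(real^'n) \<times> (real^'n)" assume le: "\<And>b. b \<in> Basis \<Longrightarrow> l \<bullet> b \<le> u \<bullet> b"
  let ?l = "\<lambda>i. (fst l $ i, snd l $ i)" and ?u = "\<lambda>i. (fst u $ i, snd u $ i)"
  have *: "fst l $ i \<le> fst u $ i" "snd l $ i \<le> snd u $ i" for i
    using le[of "(axis i 1, 0)"] le[of "(0, axis i 1)"]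
    by (auto simp: Basis_prod_def inner_prod_def inner_axis Basis_cart_eq_range)
  have "box l u = box (fst l) (fst u) \<times> box (snd l) (snd u)"
    by (cases l; cases u) (auto simp: box_def Basis_prod_def ball_Un)
  moreover have "box (?l i) (?u i) = box (fst l $ i) (fst u $ i) \<times> box (snd l $ i) (snd u $ i)" for i
    by (auto simp: box_def Basis_prod_def)
  ultimately have "?h -` box l u = PiE UNIV (\<lambda>i. box (?l i) (?u i))"
    by (auto simp: mem_box_cart PiE_def Pi_def mem_Times_iff)
  then have "emeasure (distr ?P borel ?h) (box l u) = emeasure ?P (PiE UNIV (\<lambda>i. box (?l i) (?u i)))"
    by (subst emeasure_distr) (auto simp: space_PiM)
  also have "\<dots> = (\<Prod>i\<in>UNIV. emeasure lborel (box (?l i) (?u i)))"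
    by (rule emeasure_PiM) auto
  also have "\<dots> = (\<Prod>i\<in>UNIV. ennreal ((fst u $ i - fst l $ i) * (snd u $ i - snd l $ i)))"
  proof (intro prod.cong refl)
    fix i
    have "b \<in> Basis \<Longrightarrow> ?l i \<bullet> b \<le> ?u i \<bullet> b" for b
      using * by (auto simp: Basis_prod_def)
    then show "emeasure lborel (box (?l i) (?u i)) = 
      ennreal ((fst u $ i - fst l $ i) * (snd u $ i - snd l $ i))"
      by (subst emeasure_lborel_box) (auto simp: prod_Basis_prod inner_prod_def)
  qed
  also have "\<dots> = (\<Prod>b\<in>Basis. (u - l) \<bullet> b)"
    using * by (simp add: prod_Basis_prod inner_prod_def prod_Basis_cart inner_axis prod_ennreal
      prod.distrib)
  finally show "emeasure (distr ?P borel ?h) (box l u) = (\<Prod>b\<in>Basis. (u - l) \<bullet> b)" .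
qed simp

lemma nn_integral_lborel_vec_prod:
  fixes g :: "'n::finite \<Rightarrow> real \<times> real \<Rightarrow> ennreal"
  assumes [measurable]: "\<And>i. g i \<in> borel_measurable borel"
  shows "(\<integral>\<^sup>+z. (\<Prod>i\<in>UNIV. g i (fst z $ i, snd z $ i)) \<partial>(lborel :: ((real^'n) \<times> (real^'n)) measure))
    = (\<Prod>i\<in>UNIV. \<integral>\<^sup>+p. g i p \<partial>lborel)"
proof -
  interpret product_sigma_finite "\<lambda>_ :: 'n. lborel :: (real \<times> real) measure"
    by standard
  note measurable_vec_lambda_pair[measurable]
  have [measurable]: "(\<lambda>z. g i (fst z $ i, snd z $ i)) \<in> borel_measurable (borel :: ((real^'n) \<times> (real^'n)) measure)" for i
  proof -
    have "(\<lambda>z. (fst z $ i, snd z $ i)) \<in> borel_measurable (borel :: ((real^'n) \<times> (real^'n)) measure)"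
      by (intro borel_measurable_continuous_onI continuous_intros)
    then show ?thesis by measurable
  qed
  show ?thesis
    by (subst lborel_vec_prod_eq_distr_PiM, subst nn_integral_distr)
      (simp_all add: product_nn_integral_prod borel_measurable_prod_ennreal)
qed

lemma
  fixes g :: "'n::finite \<Rightarrow> real \<Rightarrow> 'b::{real_normed_field,banach,second_countable_topology}"
  assumes g: "\<And>i. integrable lborel (g i)"
  shows integrable_lborel_vec_prod: "integrable (lborel :: (real^'n) measure) (\<lambda>x. \<Prod>i\<in>UNIV. g i (x $ i))"
    and integral_lborel_vec_prod:
      "(\<integral>x. (\<Prod>i\<in>UNIV. g i (x $ i)) \<partial>(lborel :: (real^'n) measure)) = (\<Prod>i\<in>UNIV. integral\<^sup>L lborel (g i))"
proof -
  interpret product_sigma_finite "\<lambda>_ :: 'n. lborel :: real measure"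
    by standard
  have [measurable]: "vec_lambda \<in> PiM UNIV (\<lambda>_. lborel) \<rightarrow>\<^sub>M (borel :: (real^'n) measure)"
    by measurable
  have [measurable]: "g i \<in> borel_measurable borel" for i
    using borel_measurable_integrable[OF g[of i]] by simp
  show "integrable (lborel :: (real^'n) measure) (\<lambda>x. \<Prod>i\<in>UNIV. g i (x $ i))"
    by (subst lborel_vec_eq_distr_PiM, subst integrable_distr_eq)
       (auto intro!: product_integrable_prod g)
  show "(\<integral>x. (\<Prod>i\<in>UNIV. g i (x $ i)) \<partial>(lborel :: (real^'n) measure)) = (\<Prod>i\<in>UNIV. integral\<^sup>L lborel (g i))"
    by (subst lborel_vec_eq_distr_PiM, subst integral_distr)
       (auto intro!: product_integral_prod g)
qed

section \<open>Linear change of variables\<close>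

lemma nn_integral_lborel_vec:
  assumes "f \<in> borel_measurable borel"
  shows "(\<integral>\<^sup>+x. f x \<partial>(lborel :: (real^'n) measure)) =
     (\<integral>\<^sup>+x. f (vec_lambda x) \<partial>PiM UNIV (\<lambda>_::'n. lborel :: real measure))"
proof -
  have "vec_lambda \<in> PiM UNIV (\<lambda>_. lborel) \<rightarrow>\<^sub>M (borel :: (real^'n) measure)"
    by measurable
  then show ?thesis
    by (subst lborel_vec_eq_distr_PiM, subst nn_integral_distr) (use assms in auto)
qed

text \<open>With the other coordinates fixed, the shear translates coordinate \<open>m\<close> by
  \<open>c * x $ n\<close>, a constant because \<open>m \<noteq> n\<close>. Integrating coordinate
  \<open>m\<close> first reduces the claim to translation invariance on the line.\<close>

lemma nn_integral_lborel_shear: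
  fixes f :: "real^'n \<Rightarrow> ennreal"
  assumes [measurable]: "f \<in> borel_measurable borel" and "m \<noteq> n"
  shows "(\<integral>\<^sup>+x. f x \<partial>lborel) = (\<integral>\<^sup>+x. f (\<chi> i. if i = m then x $ m + c * x $ n else x $ i) \<partial>lborel)"
proof -
  interpret product_sigma_finite "\<lambda>_ :: 'n. lborel :: real measure"
    by standard
  let ?g = "\<lambda>x :: 'n \<Rightarrow> real. f (\<chi> i. if i = m then x m + c * x n else x i)"
  let ?I = "UNIV - {m}"
  have ins: "UNIV = insert m ?I" by auto
  have [measurable]: "(\<lambda>x. x i) \<in> borel_measurable (PiM UNIV (\<lambda>_::'n. lborel :: real measure))" for i
    using measurable_component_singleton[of i UNIV "\<lambda>_. lborel :: real measure"] by simp
  have mf: "(\<lambda>x. f (vec_lambda x)) \<in> borel_measurable (PiM UNIV (\<lambda>_::'n. lborel :: real measure))"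
    by measurable
  have mg: "?g \<in> borel_measurable (PiM UNIV (\<lambda>_::'n. lborel :: real measure))"
    by measurable
  have "(\<integral>\<^sup>+x. f x \<partial>lborel) = (\<integral>\<^sup>+x. f (vec_lambda x) \<partial>PiM (insert m ?I) (\<lambda>_::'n. lborel :: real measure))"
    by (subst nn_integral_lborel_vec) auto
  also have "\<dots> = (\<integral>\<^sup>+x. (\<integral>\<^sup>+y. f (vec_lambda (x(m := y))) \<partial>lborel) \<partial>PiM ?I (\<lambda>_. lborel))"
    using mf by (subst product_nn_integral_insert) auto
  also have "\<dots> = (\<integral>\<^sup>+x. (\<integral>\<^sup>+y. ?g (x(m := y)) \<partial>lborel) \<partial>PiM ?I (\<lambda>_. lborel))"
  proof (rule nn_integral_cong)
    fix x :: "'n \<Rightarrow> real"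
    have "(\<lambda>y. \<chi> i. (x(m := y)) i) \<in> borel_measurable borel"
      by (intro borel_measurable_vec_lambda) (auto simp: fun_upd_def)
    then have [measurable]: "(\<lambda>y. f (vec_lambda (x(m := y)))) \<in> borel_measurable borel"
      by measurable
    have "(\<integral>\<^sup>+y. f (vec_lambda (x(m := y))) \<partial>lborel) =
        (\<integral>\<^sup>+y. f (vec_lambda (x(m := c * x n + 1 * y))) \<partial>lborel)"
      by (subst nn_integral_real_affine[where c=1 and t="c * x n"]) auto
    also have "\<dots> = (\<integral>\<^sup>+y. ?g (x(m := y)) \<partial>lborel)"
      using \<open>m \<noteq> n\<close> by (intro nn_integral_cong arg_cong[where f=f]) (auto simp: vec_eq_iff)
    finally show "(\<integral>\<^sup>+y. f (vec_lambda (x(m := y))) \<partial>lborel) = (\<integral>\<^sup>+y. ?g (x(m := y)) \<partial>lborel)" .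
  qed
  also have "\<dots> = (\<integral>\<^sup>+x. ?g x \<partial>PiM (insert m ?I) (\<lambda>_::'n. lborel :: real measure))"
    using mg by (subst product_nn_integral_insert) auto
  also have "\<dots> = (\<integral>\<^sup>+x. f (\<chi> i. if i = m then x $ m + c * x $ n else x $ i) \<partial>lborel)"
    by (subst nn_integral_lborel_vec) (auto cong: if_cong)
  finally show ?thesis .
qed

lemma borel_measurable_matrix_vector_mult [measurable (raw)]:
  fixes f :: "'a \<Rightarrow> real ^ 'n" and A :: "real^'n^'m"
  assumes "f \<in> borel_measurable M"
  shows "(\<lambda>x. A *v f x) \<in> borel_measurable M"
  by (rule borel_measurable_continuous_on[OF _ assms])
    (simp add: linear_continuous_on matrix_vector_mul_bounded_linear)

text \<open>The change of variables theorems of the library need a well-ordered index type.\<close>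

lemma nn_integral_lborel_linear:
  fixes f :: "real^'n \<Rightarrow> ennreal" and A :: "real^'n^'n"
  assumes "f \<in> borel_measurable borel" "det A \<noteq> 0"
  shows "(\<integral>\<^sup>+x. f x \<partial>lborel) = ennreal \<bar>det A\<bar> * (\<integral>\<^sup>+x. f (A *v x) \<partial>lborel)"
proof -
  \<comment> \<open>Quantifying over all \<open>f\<close> inside \<open>P\<close> lets the product
    case use the hypothesis on \<open>B\<close> for \<open>\<lambda>x. f (A *v x)\<close>; the
    premise \<open>det A \<noteq> 0\<close> makes the zero-row case vacuous.\<close>
  define P where "P A \<longleftrightarrow> (det A \<noteq> 0 \<longrightarrow> (\<forall>f \<in> borel_measurable borel.
     (\<integral>\<^sup>+x. f x \<partial>lborel) = ennreal \<bar>det A\<bar> * (\<integral>\<^sup>+x. f (A *v x) \<partial>lborel)))" for A :: "real^'n^'n"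
  have "P A"
  proof (rule induct_matrix_elementary)
    fix A B :: "real^'n^'n" assume A: "P A" and B: "P B"
    show "P (A ** B)"
      unfolding P_def
    proof (intro impI ballI)
      fix f :: "real^'n \<Rightarrow> ennreal"
      assume [measurable]: "f \<in> borel_measurable borel" and "det (A ** B) \<noteq> 0"
      then have "det A \<noteq> 0" "det B \<noteq> 0" by (auto simp: det_mul)
      have 1: "(\<integral>\<^sup>+x. f x \<partial>lborel) = ennreal \<bar>det A\<bar> * (\<integral>\<^sup>+x. f (A *v x) \<partial>lborel)"
        using A \<open>det A \<noteq> 0\<close> \<open>f \<in> borel_measurable borel\<close> unfolding P_def by blast
      have "(\<lambda>x. f (A *v x)) \<in> borel_measurable borel"
        by measurable
      then have 2: "(\<integral>\<^sup>+x. f (A *v x) \<partial>lborel) = ennreal \<bar>det B\<bar> * (\<integral>\<^sup>+x. f (A *v (B *v x)) \<partial>lborel)"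
        using B \<open>det B \<noteq> 0\<close> unfolding P_def by blast
      show "(\<integral>\<^sup>+x. f x \<partial>lborel) = ennreal \<bar>det (A ** B)\<bar> * (\<integral>\<^sup>+x. f ((A ** B) *v x) \<partial>lborel)"
        unfolding 1 2 by (simp add: det_mul abs_mult ennreal_mult mult.assoc flip: matrix_vector_mul_assoc)
    qed
  next
    fix A :: "real^'n^'n" and i assume "row i A = 0"
    then show "P A" by (auto simp: P_def det_zero_row)
  next
    fix A :: "real^'n^'n" assume A: "\<And>i j. i \<noteq> j \<Longrightarrow> A $ i $ j = 0"
    show "P A"
      unfolding P_def
    proof (intro impI ballI)
      fix f :: "real^'n \<Rightarrow> ennreal"
      assume [measurable]: "f \<in> borel_measurable borel" and "det A \<noteq> 0"
      have det: "det A = (\<Prod>i\<in>UNIV. A $ i $ i)"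
        using A by (rule det_diagonal)
      with \<open>det A \<noteq> 0\<close> have nz: "A $ i $ i \<noteq> 0" for i by simp
      \<comment> \<open>As \<open>A\<close> is diagonal, \<open>c b\<close> is its entry on the axis
        \<open>b\<close>, and the map is the coordinatewise scaling covered by
        \<open>lborel_affine_euclidean\<close>.\<close>
      define c where "c b = (A *v b) \<bullet> b" for b
      have c: "c (axis i 1) = A $ i $ i" for i
        by (simp add: c_def inner_axis matrix_vector_mult_basis column_def)
      have T: "A *v x = 0 + (\<Sum>j\<in>Basis. (c j * (x \<bullet> j)) *\<^sub>R j)" for x
      proof -
        have "(A *v x) \<bullet> axis i 1 = (\<Sum>j\<in>Basis. (c j * (x \<bullet> j)) *\<^sub>R j) \<bullet> axis i 1" for i
        proof -
          have "axis i 1 \<in> (Basis :: (real^'n) set)" by simp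
          then have "(\<Sum>j\<in>Basis. (c j * (x \<bullet> j)) *\<^sub>R j) \<bullet> axis i 1 = A $ i $ i * x $ i"
            by (subst inner_sum_left_Basis) (simp_all add: c inner_axis)
          also have "\<dots> = (\<Sum>j\<in>UNIV. A $ i $ j * x $ j)"
            by (subst sum.remove[of _ i]) (auto intro!: sum.neutral simp: A)
          finally show ?thesis by (simp add: inner_axis matrix_vector_mult_def)
        qed
        then show ?thesis by (simp add: vec_eq_iff inner_axis)
      qed
      have "(\<Prod>j\<in>Basis. \<bar>c j\<bar>) = \<bar>det A\<bar>"
        by (simp add: prod_Basis_cart c det abs_prod)
      moreover have "lborel = density (distr lborel borel (\<lambda>x. A *v x)) (\<lambda>_. (\<Prod>j\<in>Basis. \<bar>c j\<bar>))"
        unfolding T by (rule lborel_affine_euclidean) (use nz c in \<open>auto simp: Basis_cart_eq_range\<close>)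
      ultimately have "(\<integral>\<^sup>+x. f x \<partial>lborel) = (\<integral>\<^sup>+x. f x \<partial>density (distr lborel borel (\<lambda>x. A *v x)) (\<lambda>_. \<bar>det A\<bar>))"
        by simp
      then show "(\<integral>\<^sup>+x. f x \<partial>lborel) = ennreal \<bar>det A\<bar> * (\<integral>\<^sup>+x. f (A *v x) \<partial>lborel)"
        by (simp add: nn_integral_density nn_integral_distr nn_integral_cmult)
    qed
  next
    fix m n :: 'n assume "m \<noteq> n"
    show "P (\<chi> i j. mat 1 $ i $ Transposition.transpose m n j)" (is "P ?A")
      unfolding P_def
    proof (intro impI ballI)
      fix f :: "real^'n \<Rightarrow> ennreal"
      assume [measurable]: "f \<in> borel_measurable borel"
      have A: "?A *v x = (\<chi> i. x $ Transposition.transpose m n i)" for x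
      proof -
        have "i = Transposition.transpose m n j \<longleftrightarrow> j = Transposition.transpose m n i" for i j
          by (metis transpose_involutory)
        then have "(\<Sum>j\<in>UNIV. if i = Transposition.transpose m n j then x $ j else 0) =
            (\<Sum>j\<in>UNIV. if j = Transposition.transpose m n i then x $ j else 0)" for i
          by (intro sum.cong refl if_cong)
        then show ?thesis
          by (simp add: vec_eq_iff matrix_vector_mult_def mat_def if_distrib[of "\<lambda>a. a * b" for b] cong: if_cong)
      qed
      have det: "\<bar>det ?A\<bar> = 1"
        by (simp add: det_permute_columns permutes_swap_id sign_swap_id abs_mult)
      have "lborel = distr lborel borel (\<lambda>x. ?A *v x)"
      proof (rule lborel_eqI)
        fix l u :: "real^'n" assume le: "\<And>b. b \<in> Basis \<Longrightarrow> l \<bullet> b \<le> u \<bullet> b"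
        have le': "l $ i \<le> u $ i" for i
          using le[of "axis i 1"] by (simp add: inner_axis)
        have "((*v) ?A) -` box l u = box (?A *v l) (?A *v u)"
          unfolding A by (auto simp: mem_box_cart) (metis transpose_involutory)+
        then have "emeasure (distr lborel borel (\<lambda>x. ?A *v x)) (box l u) = emeasure lborel (box (?A *v l) (?A *v u))"
          by (subst emeasure_distr) auto
        also have "\<dots> = (\<Prod>b\<in>Basis. (?A *v u - ?A *v l) \<bullet> b)"
          using le' by (subst emeasure_lborel_box) (auto simp: A Basis_cart_eq_range inner_axis)
        also have "(\<Prod>b\<in>Basis. (?A *v u - ?A *v l) \<bullet> b) =
          (\<Prod>i\<in>UNIV. (\<lambda>i. u $ i - l $ i) (Transposition.transpose m n i))"
          by (simp add: A prod_Basis_cart inner_axis)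
        also have "\<dots> = (\<Prod>i\<in>UNIV. u $ i - l $ i)"
          using prod.permute [OF permutes_swap_id, where S=UNIV and g="\<lambda>i. u $ i - l $ i"]
          by (simp add: o_def)
        finally show "emeasure (distr lborel borel (\<lambda>x. ?A *v x)) (box l u) = (\<Prod>b\<in>Basis. (u - l) \<bullet> b)"
          by (simp add: prod_Basis_cart inner_axis)
      qed simp
      then have "(\<integral>\<^sup>+x. f x \<partial>lborel) = (\<integral>\<^sup>+x. f x \<partial>distr lborel borel (\<lambda>x. ?A *v x))"
        by simp
      then show "(\<integral>\<^sup>+x. f x \<partial>lborel) = ennreal \<bar>det ?A\<bar> * (\<integral>\<^sup>+x. f (?A *v x) \<partial>lborel)"
        unfolding det by (simp add: nn_integral_distr)
    qed
  next
    fix m n :: 'n and c :: real assume "m \<noteq> n"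
    show "P (\<chi> i j. if i = m \<and> j = n then c else of_bool (i = j))" (is "P ?A")
      unfolding P_def
    proof (intro impI ballI)
      fix f :: "real^'n \<Rightarrow> ennreal"
      assume [measurable]: "f \<in> borel_measurable borel"
      have A: "?A *v x = (\<chi> i. if i = m then x $ m + c * x $ n else x $ i)" for x
      proof -
        have "(\<Sum>j\<in>UNIV. ?A $ m $ j * x $ j) = x $ m + c * x $ n"
          using \<open>m \<noteq> n\<close> by (subst sum.remove[of _ m], simp, simp, subst sum.remove[of _ n]) (auto intro!: sum.neutral)
        moreover have "(\<Sum>j\<in>UNIV. ?A $ i $ j * x $ j) = x $ i" if "i \<noteq> m" for i
          using that by (subst sum.remove[of _ i]) (auto intro!: sum.neutral)
        ultimately show ?thesis
          by (simp add: vec_eq_iff matrix_vector_mult_def)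
      qed
      \<comment> \<open>The matrix arises from the identity by adding \<open>c\<close> times row
        \<open>n\<close> to row \<open>m\<close>, which does not change the determinant.\<close>
      have "det ?A = det (\<chi> k. if k = m then row m (mat 1 :: real^'n^'n) + c *s row n (mat 1) else row k (mat 1))"
        using \<open>m \<noteq> n\<close>
        by (intro arg_cong[where f=det]) (auto simp: vec_eq_iff row_def mat_def)
      also have "\<dots> = 1"
        using \<open>m \<noteq> n\<close> by (subst det_row_operation) auto
      finally show "(\<integral>\<^sup>+x. f x \<partial>lborel) = ennreal \<bar>det ?A\<bar> * (\<integral>\<^sup>+x. f (?A *v x) \<partial>lborel)"
        using nn_integral_lborel_shear[of f m n c] \<open>m \<noteq> n\<close> by (simp add: A)
    qed
  qed
  with assms show ?thesis
    unfolding P_def by blast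
qed

lemma integrable_scaleR_right_iff:
  fixes f :: "'a \<Rightarrow> 'b::{banach,second_countable_topology}"
  assumes "c \<noteq> 0"
  shows "integrable M (\<lambda>x. c *\<^sub>R f x) \<longleftrightarrow> integrable M f"
proof
  assume "integrable M (\<lambda>x. c *\<^sub>R f x)"
  then have "integrable M (\<lambda>x. inverse c *\<^sub>R c *\<^sub>R f x)" by (rule integrable_scaleR_right)
  moreover have "(\<lambda>x. inverse c *\<^sub>R c *\<^sub>R f x) = f" using assms by simp
  ultimately show "integrable M f" by (simp only:)
qed simp

lemma lborel_linear:
  fixes A :: "real^'n^'n"
  assumes "det A \<noteq> 0"
  shows "lborel = density (distr lborel borel (\<lambda>x. A *v x)) (\<lambda>_. ennreal \<bar>det A\<bar>)"
proof (rule measure_eqI)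
  fix S assume "S \<in> sets (lborel :: (real^'n) measure)"
  then have [measurable]: "S \<in> sets borel" by simp
  have "emeasure lborel S = ennreal \<bar>det A\<bar> * (\<integral>\<^sup>+x. indicator S (A *v x) \<partial>lborel)"
    using nn_integral_lborel_linear[OF _ assms, of "indicator S"] by simp
  also have "(\<integral>\<^sup>+x. indicator S (A *v x) \<partial>lborel) = (\<integral>\<^sup>+x. indicator S x \<partial>distr lborel borel (\<lambda>x. A *v x))"
    by (subst nn_integral_distr) auto
  also have "ennreal \<bar>det A\<bar> * \<dots> = emeasure (density (distr lborel borel (\<lambda>x. A *v x)) (\<lambda>_. ennreal \<bar>det A\<bar>)) S"
    by (simp add: emeasure_density nn_integral_cmult)
  finally show "emeasure lborel S = \<dots>" .
qed simp

lemma integral_lborel_linear: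
  fixes A :: "real^'n^'n" and f :: "real^'n \<Rightarrow> 'b::{banach,second_countable_topology}"
  assumes "det A \<noteq> 0" and [measurable]: "f \<in> borel_measurable borel"
  shows "integral\<^sup>L lborel f = \<bar>det A\<bar> *\<^sub>R (\<integral>x. f (A *v x) \<partial>lborel)"
  by (subst lborel_linear[OF assms(1)]) (simp add: integral_density integral_distr)

lemma measurable_map_prod_matrix [measurable]:
  "(\<lambda>z. (A *v fst z, A *v snd z)) \<in> borel_measurable (borel :: ((real^'n) \<times> (real^'n)) measure)"
  for A :: "real^'n^'n"
  by (intro borel_measurable_continuous_onI continuous_on_Pair
      continuous_on_compose2[OF matrix_vector_mult_linear_continuous_on[of UNIV A]] continuous_intros) auto

text \<open>A real matrix acts on real and imaginary parts separately, so the formula for one block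
  is used twice under Tonelli; hence the square of the determinant.\<close>

lemma lborel_linear_prod:
  fixes A :: "real^'n^'n"
  assumes "det A \<noteq> 0"
  shows "(lborel :: ((real^'n) \<times> (real^'n)) measure) =
    density (distr lborel borel (\<lambda>z. (A *v fst z, A *v snd z))) (\<lambda>_. ennreal ((det A)\<^sup>2))"
    (is "_ = density (distr lborel borel ?T) _")
proof (rule measure_eqI)
  fix S assume "S \<in> sets (lborel :: ((real^'n) \<times> (real^'n)) measure)"
  then have [measurable]: "S \<in> sets borel" by simp
  then have S [measurable]: "S \<in> sets (borel \<Otimes>\<^sub>M borel)" by (simp only: borel_prod)
  have "emeasure lborel S = emeasure (lborel \<Otimes>\<^sub>M lborel) S"
    by (simp add: lborel_prod)
  also have "\<dots> = (\<integral>\<^sup>+x. \<integral>\<^sup>+y. indicator S (x, y) \<partial>lborel \<partial>lborel)"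
    by (subst lborel.nn_integral_fst) (simp_all add: S)
  also have "\<dots> = (\<integral>\<^sup>+x. ennreal \<bar>det A\<bar> * (\<integral>\<^sup>+y. indicator S (x, A *v y) \<partial>lborel) \<partial>lborel)"
    by (subst nn_integral_lborel_linear[OF _ assms, where f="\<lambda>y. indicator S (_, y)"]) auto
  also have "\<dots> = ennreal \<bar>det A\<bar> * (ennreal \<bar>det A\<bar> * (\<integral>\<^sup>+x. \<integral>\<^sup>+y. indicator S (A *v x, A *v y) \<partial>lborel \<partial>lborel))"
    by (subst nn_integral_cmult, measurable) (subst nn_integral_lborel_linear[OF _ assms], auto)
  also have "(\<integral>\<^sup>+x. \<integral>\<^sup>+y. indicator S (A *v x, A *v y) \<partial>lborel \<partial>lborel) =
      (\<integral>\<^sup>+z. indicator S (?T z) \<partial>(lborel \<Otimes>\<^sub>M lborel))"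
    by (subst lborel.nn_integral_fst[symmetric]) auto
  also have "ennreal \<bar>det A\<bar> * (ennreal \<bar>det A\<bar> * \<dots>) = ennreal ((det A)\<^sup>2) * (\<integral>\<^sup>+z. indicator S (?T z) \<partial>lborel)"
    by (simp add: lborel_prod power2_eq_square mult.assoc[symmetric] ennreal_mult[symmetric])
  also have "(\<integral>\<^sup>+z. indicator S (?T z) \<partial>lborel) = (\<integral>\<^sup>+z. indicator S z \<partial>distr lborel borel ?T)"
    by (subst nn_integral_distr) auto
  also have "ennreal ((det A)\<^sup>2) * \<dots> = emeasure (density (distr lborel borel ?T) (\<lambda>_. ennreal ((det A)\<^sup>2))) S"
    by (simp add: emeasure_density nn_integral_cmult)
  finally show "emeasure lborel S = \<dots>" .
qed simp

lemma
  fixes A :: "real^'n^'n" and f :: "(real^'n) \<times> (real^'n) \<Rightarrow> 'b::{banach,second_countable_topology}"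
  assumes "det A \<noteq> 0" and [measurable]: "f \<in> borel_measurable borel"
  shows integrable_lborel_linear_prod:
      "integrable lborel f \<longleftrightarrow> integrable lborel (\<lambda>z. f (A *v fst z, A *v snd z))"
    and integral_lborel_linear_prod:
      "integral\<^sup>L lborel f = (det A)\<^sup>2 *\<^sub>R (\<integral>z. f (A *v fst z, A *v snd z) \<partial>lborel)"
proof -
  have "integrable lborel f \<longleftrightarrow> integrable lborel (\<lambda>z. (det A)\<^sup>2 *\<^sub>R f (A *v fst z, A *v snd z))"
    by (subst lborel_linear_prod[OF assms(1)]) (simp add: integrable_density integrable_distr_eq)
  also have "\<dots> \<longleftrightarrow> integrable lborel (\<lambda>z. f (A *v fst z, A *v snd z))"
    using assms(1) by (intro integrable_scaleR_right_iff) auto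
  finally show "integrable lborel f \<longleftrightarrow> integrable lborel (\<lambda>z. f (A *v fst z, A *v snd z))" .
  show "integral\<^sup>L lborel f = (det A)\<^sup>2 *\<^sub>R (\<integral>z. f (A *v fst z, A *v snd z) \<partial>lborel)"
    by (subst lborel_linear_prod[OF assms(1)]) (simp add: integral_density integral_distr)
qed

section \<open>Complex Gaussian integrals\<close>

text \<open>Gram-Schmidt for the inner product \<open>x \<bullet> (P *v y)\<close>: a
  \<open>P\<close>-orthonormal set is enlarged one vector at a time, and the final
  \<open>CARD('n)\<close> vectors are the columns of \<open>M\<close>.\<close>

lemma positive_definite_diagonalizable:
  fixes P :: "real^'n^'n"
  assumes sym: "transpose P = P" and pos: "\<And>x. x \<noteq> 0 \<Longrightarrow> 0 < x \<bullet> (P *v x)"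
  shows "\<exists>M :: real^'n^'n. transpose M ** (P ** M) = mat 1"
proof -
  have comm: "x \<bullet> (P *v y) = y \<bullet> (P *v x)" for x y
    by (metis dot_lmul_matrix inner_commute sym transpose_matrix_vector)
  have "k \<le> CARD('n) \<Longrightarrow> \<exists>B. finite B \<and> card B = k \<and> (\<forall>a\<in>B. \<forall>b\<in>B. a \<bullet> (P *v b) = (if a = b then 1 else 0))" for k
  proof (induction k)
    case 0
    show ?case by (intro exI[of _ "{}"]) auto
  next
    case (Suc k)
    then obtain B where B: "finite B" "card B = k"
      "\<And>a b. a \<in> B \<Longrightarrow> b \<in> B \<Longrightarrow> a \<bullet> (P *v b) = (if a = b then 1 else 0)"
      by (metis Suc_leD)
    \<comment> \<open>The images \<open>P *v b\<close> span fewer than \<open>CARD('n)\<close>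
      dimensions, so some nonzero \<open>x\<close> is orthogonal to all of them, which is
      \<open>P\<close>-orthogonality to \<open>B\<close>. Positivity allows it to be
      normalized.\<close>
    have "dim (span ((*v) P ` B)) \<le> card ((*v) P ` B)"
      using B by (simp add: dim_le_card')
    also have "\<dots> \<le> k" using B card_image_le by blast
    finally have "dim ((*v) P ` B) < DIM(real^'n)" using Suc.prems by simp
    then obtain x where x: "x \<noteq> 0" "\<And>y. y \<in> span ((*v) P ` B) \<Longrightarrow> orthogonal x y"
      using orthogonal_to_subspace_exists by blast
    define y where "y = (1 / sqrt (x \<bullet> (P *v x))) *\<^sub>R x"
    have y1: "y \<bullet> (P *v y) = 1"
      using pos[OF x(1)] by (simp add: y_def matrix_vector_mult_scaleR)
    have y0: "y \<bullet> (P *v b) = 0" if "b \<in> B" for b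
      using x(2)[of "P *v b"] that by (simp add: y_def span_base orthogonal_def)
    then have "y \<notin> B" using y1 by auto
    then show ?case
      using B y1 y0 comm by (intro exI[of _ "insert y B"]) auto
  qed
  from this[OF order_refl] obtain B where B: "finite B" "card B = CARD('n)"
      "\<And>a b. a \<in> B \<Longrightarrow> b \<in> B \<Longrightarrow> a \<bullet> (P *v b) = (if a = b then 1 else 0)"
    by metis
  then obtain g where g: "bij_betw g (UNIV :: 'n set) B"
    using finite_same_card_bij[of "UNIV :: 'n set" B] by auto
  define M where "M = (\<chi> i j. g j $ i)"
  have "(transpose M ** (P ** M)) $ i $ j = g i \<bullet> (P *v g j)" for i j
    by (simp add: M_def matrix_matrix_mult_def transpose_def inner_vec_def matrix_vector_mult_def)
  also have "\<dots> i j = (mat 1 :: real^'n^'n) $ i $ j" for i j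
    using g by (subst B(3)) (auto simp: bij_betw_def mat_def inj_on_def)
  finally have "transpose M ** (P ** M) = mat 1" by (simp only: vec_eq_iff simp_thms)
  then show ?thesis ..
qed

text \<open>Along the segment from the identity to \<open>A\<close> the form stays positive, so no
  matrix on it has a kernel; by the intermediate value theorem the determinant keeps the sign it has
  at the identity. This covers nonsymmetric \<open>A\<close>.\<close>

lemma det_pos_of_positive_form:
  fixes A :: "real^'n^'n"
  assumes pos: "\<And>x. x \<noteq> 0 \<Longrightarrow> 0 < x \<bullet> (A *v x)"
  shows "0 < det A"
proof (rule ccontr)
  assume "\<not> 0 < det A"
  define B where "B t = (1 - t) *\<^sub>R mat 1 + t *\<^sub>R A" for t :: real
  have "continuous_on {0..1} (\<lambda>t. det (B t))"
    unfolding det_def B_def by (intro continuous_intros)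
  then obtain t where t: "0 \<le> t" "t \<le> 1" "det (B t) = 0"
    using IVT2'[of "\<lambda>t. det (B t)" 1 0 0] \<open>\<not> 0 < det A\<close> by (auto simp: B_def)
  then obtain x where x: "x \<noteq> 0" "B t *v x = 0"
    by (metis invertible_det_nz invertible_left_inverse matrix_left_invertible_ker)
  have "x \<bullet> (B t *v x) = (1 - t) * (x \<bullet> x) + t * (x \<bullet> (A *v x))"
    by (simp add: B_def matrix_vector_mult_add_rdistrib scaleR_matrix_vector_assoc[symmetric] inner_add_right)
  moreover have "0 < \<dots>"
  proof (cases "t = 0")
    case False
    then have "0 < t * (x \<bullet> (A *v x))" using t pos[OF x(1)] by simp
    then show ?thesis using t by (simp add: add_nonneg_pos)
  qed (use x in simp)
  ultimately show False using x by simp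
qed

text \<open>This is the characteristic function of the standard normal law at
  \<open>sqrt 2 * c\<close>, after the substitution \<open>x = sqrt 2 * t\<close> that turns
  \<open>x\<^sup>2 / 2\<close> into \<open>t\<^sup>2\<close>.\<close>

lemma
  fixes c :: real
  shows integrable_gaussian_fourier:
      "integrable lborel (\<lambda>t::real. exp (- of_real (t\<^sup>2) + 2 * \<i> * of_real (c * t)) :: complex)"
    and integral_gaussian_fourier:
      "(\<integral>t. exp (- of_real (t\<^sup>2) + 2 * \<i> * of_real (c * t)) \<partial>lborel) = complex_of_real (sqrt pi * exp (- c\<^sup>2))"
proof -
  let ?f = "\<lambda>x. std_normal_density x *\<^sub>R iexp (sqrt 2 * c * x)"
  have eq: "exp (- of_real (t\<^sup>2) + 2 * \<i> * of_real (c * t)) = complex_of_real (sqrt (2 * pi)) * ?f (0 + sqrt 2 * t)" for t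
  proof -
    have "sqrt 2 * c * (sqrt 2 * t) = 2 * (c * t)" by (simp add: algebra_simps)
    moreover have "(sqrt 2 * t)\<^sup>2 / 2 = t\<^sup>2" by (simp add: power_mult_distrib)
    ultimately show ?thesis
      by (simp add: std_normal_density_def exp_add scaleR_conv_of_real exp_of_real[symmetric] exp_diff exp_minus field_simps)
  qed
  have int: "integrable lborel ?f"
    by (rule Bochner_Integration.integrable_bound[OF integrable_normal_density[of 1 0]])
      (auto simp: normal_density_nonneg)
  have "integrable lborel (\<lambda>t. ?f (0 + sqrt 2 * t))"
    by (rule lborel_integrable_real_affine[OF int]) simp
  then show "integrable lborel (\<lambda>t::real. exp (- of_real (t\<^sup>2) + 2 * \<i> * of_real (c * t)) :: complex)"
    unfolding eq by (intro integrable_mult_right)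
  have "exp (- (sqrt 2 * c)\<^sup>2 / 2) = (\<integral>x. iexp (sqrt 2 * c * x) \<partial>std_normal_distribution)"
    using fun_cong[OF char_std_normal_distribution, of "sqrt 2 * c"] by (simp only: char_def)
  also have "\<dots> = (\<integral>x. ?f x \<partial>lborel)"
    by (subst integral_density) (auto simp: normal_density_nonneg)
  also have "\<dots> = sqrt 2 *\<^sub>R (\<integral>t. ?f (0 + sqrt 2 * t) \<partial>lborel)"
    by (subst lborel_integral_real_affine[where c="sqrt 2" and t=0]) auto
  finally have "(\<integral>t. ?f (0 + sqrt 2 * t) \<partial>lborel) = of_real (exp (- c\<^sup>2) / sqrt 2)"
    by (simp add: power_mult_distrib scaleR_conv_of_real field_simps)
  then show "(\<integral>t. exp (- of_real (t\<^sup>2) + 2 * \<i> * of_real (c * t)) \<partial>lborel) = complex_of_real (sqrt pi * exp (- c\<^sup>2))"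
    unfolding eq by (subst integral_mult_right_zero) (simp add: real_sqrt_mult)
qed

lemma integrable_gaussian: "integrable lborel (\<lambda>t::real. exp (- t\<^sup>2))"
  using integrable_gaussian_fourier[of 0, THEN integrable_norm] by simp

lemma integral_gaussian: "(\<integral>t. exp (- (t::real)\<^sup>2) \<partial>lborel) = sqrt pi"
proof -
  have "complex_of_real (\<integral>t. exp (- (t::real)\<^sup>2) \<partial>lborel) = (\<integral>t. complex_of_real (exp (- t\<^sup>2)) \<partial>lborel)"
    by (rule integral_complex_of_real[symmetric])
  also have "\<dots> = (\<integral>t. exp (- of_real (t\<^sup>2) + 2 * \<i> * of_real (0 * t)) \<partial>lborel)"
    by (simp only: exp_of_real[symmetric] of_real_minus) simp
  also have "\<dots> = complex_of_real (sqrt pi)"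
    by (subst integral_gaussian_fourier) simp
  finally show ?thesis by (simp only: of_real_eq_iff)
qed

lemma exp_inner_self_eq_prod: "exp (- (x \<bullet> x)) = (\<Prod>i\<in>UNIV. exp (- (x $ i)\<^sup>2))" for x :: "real^'n"
  by (simp add: inner_vec_def exp_sum[symmetric] sum_negf power2_eq_square)

lemma
  shows integrable_gaussian_vec: "integrable lborel (\<lambda>x::real^'n. exp (- (x \<bullet> x)))"
    and integral_gaussian_vec: "(\<integral>x. exp (- (x \<bullet> x)) \<partial>(lborel :: (real^'n) measure)) = sqrt pi ^ CARD('n)"
  unfolding exp_inner_self_eq_prod
  by (auto intro!: integrable_lborel_vec_prod integrable_gaussian
    simp: integral_lborel_vec_prod[OF integrable_gaussian] integral_gaussian)

text \<open>With \<open>z = x + \<i> y\<close>, this is the sesquilinear form \<open>\<Sum>i j. A\<^sub>i\<^sub>j z\<^sub>i cnj z\<^sub>j\<close>.\<close>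

definition herm :: "real^'n^'n \<Rightarrow> (real^'n) \<times> (real^'n) \<Rightarrow> complex" where
  "herm A z = of_real (fst z \<bullet> (A *v fst z) + snd z \<bullet> (A *v snd z))
     + \<i> * of_real (snd z \<bullet> (A *v fst z) - fst z \<bullet> (A *v snd z))"

lemma continuous_on_matrix_vector_mult [continuous_intros]:
  fixes f :: "'a::topological_space \<Rightarrow> real ^ 'n" and A :: "real^'n^'m"
  shows "continuous_on S f \<Longrightarrow> continuous_on S (\<lambda>x. A *v f x)"
  by (rule continuous_on_compose2[OF matrix_vector_mult_linear_continuous_on[of UNIV A]]) auto

lemma continuous_on_herm [continuous_intros]:
  "continuous_on S f \<Longrightarrow> continuous_on S (\<lambda>x. herm A (f x))"
  unfolding herm_def by (intro continuous_intros)

lemma borel_measurable_herm [measurable (raw)]: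
  "f \<in> borel_measurable M \<Longrightarrow> (\<lambda>x. herm A (f x)) \<in> borel_measurable M"
  by (rule borel_measurable_continuous_on[where f="herm A"]) (auto intro!: continuous_intros)

lemma inner_matrix_congruence:
  fixes A :: "real^'n^'n" and M :: "real^'m^'n"
  shows "(M *v x) \<bullet> (A *v (M *v y)) = x \<bullet> ((transpose M ** (A ** M)) *v y)"
  by (metis dot_lmul_matrix matrix_vector_mul_assoc transpose_matrix_vector transpose_transpose)

text \<open>A real \<open>M\<close> commutes with complex conjugation, so a linear substitution in
  \<open>z\<close> is a congruence of the real matrix \<open>A\<close>.\<close>

lemma herm_congruence: "herm A (M *v fst z, M *v snd z) = herm (transpose M ** (A ** M)) z"
  by (simp add: herm_def inner_matrix_congruence)

text \<open>
  Integrating first over the real part \<open>u\<close> is a Gaussian Fourier transform; it leaves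
  \<open>exp (- (|v|\<^sup>2 + |N v - v|\<^sup>2)) = exp (- |N v|\<^sup>2)\<close>, which the substitution \<open>w = N v\<close> integrates.
\<close>

lemma
  fixes N :: "real^'n^'n"
  assumes N: "\<And>x y. x \<bullet> (N *v y) + y \<bullet> (N *v x) = 2 * (x \<bullet> y)"
  shows integrable_exp_herm_normalized: "integrable lborel (\<lambda>z. exp (- herm N z))"
    and integral_exp_herm_normalized:
      "(\<integral>z. exp (- herm N z) \<partial>lborel) = complex_of_real (pi ^ CARD('n) / \<bar>det N\<bar>)"
proof -
  \<comment> \<open>The assumption says that the symmetric part of \<open>N\<close> is the
    identity.\<close>
  have NN: "x \<bullet> (N *v x) = x \<bullet> x" for x
    using N[of x x] by simp
  have det: "det N > 0"
    by (rule det_pos_of_positive_form) (simp add: NN)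
  \<comment> \<open>For fixed \<open>v\<close> the integrand is a Gaussian in \<open>u\<close> times
    a character with frequency vector \<open>N *v v - v\<close>, hence a product over the
    coordinates of \<open>u\<close>.\<close>
  have herm_N: "exp (- herm N (u, v)) = complex_of_real (exp (- (v \<bullet> v))) *
      (\<Prod>i\<in>UNIV. exp (- of_real ((u $ i)\<^sup>2) + 2 * \<i> * of_real ((N *v v - v) $ i * u $ i)))" for u v
  proof -
    have "v \<bullet> (N *v u) - u \<bullet> (N *v v) = - 2 * (u \<bullet> (N *v v - v))"
      using N[of u v] by (simp add: inner_diff_right)
    then have "- herm N (u, v) = - of_real (v \<bullet> v) + (- of_real (u \<bullet> u) + 2 * \<i> * of_real (u \<bullet> (N *v v - v)))"
      by (simp add: herm_def NN)
    also have "- of_real (u \<bullet> u) + 2 * \<i> * of_real (u \<bullet> (N *v v - v)) =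
      (\<Sum>i\<in>UNIV. - of_real ((u $ i)\<^sup>2) + 2 * \<i> * of_real ((N *v v - v) $ i * u $ i))"
      by (simp add: inner_vec_def sum.distrib sum_negf sum_subtractf sum_distrib_left power2_eq_square mult_ac)
    finally show ?thesis
      by (simp only: exp_add exp_sum[OF finite] exp_of_real[symmetric] of_real_minus)
  qed
  \<comment> \<open>The skew part of \<open>N\<close> contributes only a phase, so absolute
    integrability is that of the standard Gaussian.\<close>
  have norm_herm: "norm (exp (- herm N (u, v))) = exp (- (u \<bullet> u)) * exp (- (v \<bullet> v))" for u v
    by (simp add: norm_exp_eq_Re herm_def NN flip: exp_add del: exp_diff)
  have [measurable]: "(\<lambda>z. exp (- herm N z)) \<in> borel_measurable borel"
    by measurable
  have int: "integrable (lborel \<Otimes>\<^sub>M lborel) (\<lambda>z. exp (- herm N z))"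
  proof (rule lborel_pair.Fubini_integrable)
    show "(\<lambda>z. exp (- herm N z)) \<in> borel_measurable (lborel \<Otimes>\<^sub>M lborel)"
      by (simp add: lborel_prod)
    show "integrable lborel (\<lambda>x. LBINT y. norm (exp (- herm N (x, y))))"
      unfolding norm_herm by (simp add: integrable_gaussian_vec)
    show "AE x in lborel. integrable lborel (\<lambda>y. exp (- herm N (x, y)))"
    proof (intro AE_I2)
      fix u :: "real^'n"
      have "integrable lborel (\<lambda>v. norm (exp (- herm N (u, v))))"
        unfolding norm_herm by (simp add: integrable_gaussian_vec)
      then show "integrable lborel (\<lambda>v. exp (- herm N (u, v)))"
        by (subst (asm) integrable_norm_iff) auto
    qed
  qed
  then show "integrable lborel (\<lambda>z. exp (- herm N z))"
    by (simp add: lborel_prod)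
  have inner: "(\<integral>u. exp (- herm N (u, v)) \<partial>lborel) = complex_of_real (sqrt pi ^ CARD('n) * exp (- ((N *v v) \<bullet> (N *v v))))" for v
  proof -
    let ?c = "N *v v - v"
    \<comment> \<open>In the expansion of \<open>?c \<bullet> ?c\<close> the mixed terms are
      \<open>- 2 * (v \<bullet> v)\<close> by \<open>NN\<close>, which cancels both copies of
      \<open>v \<bullet> v\<close>.\<close>
    have "v \<bullet> v + ?c \<bullet> ?c = (N *v v) \<bullet> (N *v v)"
      using NN[of v] by (simp add: inner_diff_left inner_diff_right inner_commute)
    then have e: "exp (- (v \<bullet> v)) * exp (- (?c \<bullet> ?c)) = exp (- ((N *v v) \<bullet> (N *v v)))"
      by (simp add: exp_add[symmetric])
    have "(\<integral>u. exp (- herm N (u, v)) \<partial>lborel) = complex_of_real (exp (- (v \<bullet> v))) *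
       (\<Prod>i\<in>UNIV. complex_of_real (sqrt pi * exp (- (?c $ i)\<^sup>2)))"
      unfolding herm_N integral_mult_right_zero
      by (subst integral_lborel_vec_prod[OF integrable_gaussian_fourier]) (simp only: integral_gaussian_fourier)
    also have "\<dots> = complex_of_real (sqrt pi ^ CARD('n) * (exp (- (v \<bullet> v)) * exp (- (?c \<bullet> ?c))))"
      unfolding exp_inner_self_eq_prod[of ?c] by (simp add: prod.distrib)
    finally show ?thesis unfolding e .
  qed
  have "(\<integral>z. exp (- herm N z) \<partial>lborel) = (\<integral>v. \<integral>u. exp (- herm N (u, v)) \<partial>lborel \<partial>lborel)"
    using lborel_pair.integral_snd[of "\<lambda>u v. exp (- herm N (u, v))"] int
    by (simp add: lborel_prod split_def)
  also have "\<dots> = complex_of_real (sqrt pi ^ CARD('n) * (\<integral>v. exp (- ((N *v v) \<bullet> (N *v v))) \<partial>lborel))"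
    unfolding inner by (simp only: integral_complex_of_real integral_mult_right_zero)
  also have "(\<integral>v. exp (- ((N *v v) \<bullet> (N *v v))) \<partial>lborel) = sqrt pi ^ CARD('n) / \<bar>det N\<bar>"
    using integral_lborel_linear[of N "\<lambda>w. exp (- (w \<bullet> w))"] det
    by (simp add: integral_gaussian_vec field_simps)
  also have "sqrt pi ^ CARD('n) * (sqrt pi ^ CARD('n) / \<bar>det N\<bar>) = pi ^ CARD('n) / \<bar>det N\<bar>"
    by (simp add: power_mult_distrib[symmetric])
  finally show "(\<integral>z. exp (- herm N z) \<partial>lborel) = complex_of_real (pi ^ CARD('n) / \<bar>det N\<bar>)" .
qed

text \<open>A congruence \<open>M\<close> that turns the symmetric part \<open>P\<close> of
  \<open>A\<close> into the identity brings \<open>A\<close> to the normalized case. The factor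
  \<open>(det M)\<^sup>2\<close> of the substitution cancels against the one in
  \<open>det N\<close>.\<close>

lemma
  fixes A :: "real^'n^'n"
  assumes pos: "\<And>x. x \<noteq> 0 \<Longrightarrow> 0 < x \<bullet> (A *v x)"
  shows integrable_exp_herm: "integrable lborel (\<lambda>z. exp (- herm A z))"
    and integral_exp_herm: "(\<integral>z. exp (- herm A z) \<partial>lborel) = complex_of_real (pi ^ CARD('n) / det A)"
proof -
  define P where "P = (1 / 2) *\<^sub>R (A + transpose A)"
  have P: "x \<bullet> (P *v y) = (x \<bullet> (A *v y) + y \<bullet> (A *v x)) / 2" for x y
  proof -
    have "x \<bullet> (transpose A *v y) = y \<bullet> (A *v x)"
      by (metis dot_lmul_matrix inner_commute transpose_matrix_vector)
    then show ?thesis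
      by (simp add: P_def matrix_vector_mult_add_rdistrib scaleR_matrix_vector_assoc[symmetric] inner_add_right)
  qed
  have "transpose P = P"
    by (simp add: P_def transpose_def vec_eq_iff)
  then obtain M :: "real^'n^'n" where M: "transpose M ** (P ** M) = mat 1"
    using positive_definite_diagonalizable[of P] pos by (auto simp: P)
  define N where "N = transpose M ** (A ** M)"
  have N: "x \<bullet> (N *v y) + y \<bullet> (N *v x) = 2 * (x \<bullet> y)" for x y
  proof -
    have "x \<bullet> (N *v y) + y \<bullet> (N *v x) = 2 * ((M *v x) \<bullet> (P *v (M *v y)))"
      by (simp add: N_def inner_matrix_congruence[symmetric] P)
    also have "\<dots> = 2 * (x \<bullet> y)"
      by (simp add: inner_matrix_congruence M)
    finally show ?thesis .
  qed
  have "det (transpose M ** (P ** M)) = 1"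
    by (simp add: M)
  then have detM: "det M \<noteq> 0"
    by (auto simp: det_mul)
  have detN: "det N = (det M)\<^sup>2 * det A"
    by (simp add: N_def det_mul power2_eq_square)
  have detA: "det A > 0"
    using pos by (rule det_pos_of_positive_form)
  have [measurable]: "(\<lambda>z. exp (- herm A z)) \<in> borel_measurable borel"
    by measurable
  show "integrable lborel (\<lambda>z. exp (- herm A z))"
    by (subst integrable_lborel_linear_prod[OF detM])
      (auto simp: herm_congruence integrable_exp_herm_normalized[OF N, unfolded N_def])
  have "(\<integral>z. exp (- herm A z) \<partial>lborel) = (det M)\<^sup>2 *\<^sub>R (\<integral>z. exp (- herm N z) \<partial>lborel)"
    by (subst integral_lborel_linear_prod[OF detM]) (auto simp: herm_congruence N_def)
  also have "\<dots> = complex_of_real ((det M)\<^sup>2 * (pi ^ CARD('n) / \<bar>det N\<bar>))"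
    by (subst integral_exp_herm_normalized[OF N]) (simp add: scaleR_conv_of_real)
  also have "(det M)\<^sup>2 * (pi ^ CARD('n) / \<bar>det N\<bar>) = pi ^ CARD('n) / det A"
    using detA detM by (simp add: detN abs_mult)
  finally show "(\<integral>z. exp (- herm A z) \<partial>lborel) = complex_of_real (pi ^ CARD('n) / det A)" .
qed

section \<open>Polar coordinates\<close>

text \<open>The first coordinate is the squared radius: it is the variable \<open>l\<close> of the
  density, and it makes the Jacobian constant.\<close>

definition polar :: "real \<times> real \<Rightarrow> real \<times> real" where
  "polar p = (sqrt (fst p) * cos (snd p), sqrt (fst p) * sin (snd p))"

lemma borel_measurable_polar [measurable]: "polar \<in> borel_measurable borel"
  unfolding polar_def by (intro borel_measurable_continuous_onI continuous_intros)

definition polar_domain :: "(real \<times> real) set" where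
  "polar_domain = {0<..} \<times> {0<..<2 * pi}"

lemma polar_domain_measurable [measurable]: "polar_domain \<in> sets borel"
  unfolding polar_domain_def by (intro borel_open open_Times) auto

lemma polar_inverse:
  assumes "p \<in> polar_domain"
  defines "z \<equiv> Complex (fst (polar p)) (snd (polar p))"
  shows "p = ((cmod z)\<^sup>2, Arg2pi z)"
proof -
  obtain l \<theta> where p: "p = (l, \<theta>)" and l: "0 < l" and \<theta>: "0 < \<theta>" "\<theta> < 2 * pi"
    using assms(1) by (cases p) (auto simp: polar_domain_def)
  have z: "z = of_real (sqrt l) * exp (\<i> * of_real \<theta>)"
    by (simp add: z_def p polar_def complex_eq_iff Re_exp Im_exp)
  have "Arg2pi z = \<theta>"
    by (rule Arg2pi_unique[of "sqrt l"]) (use l \<theta> z in auto)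
  moreover have "(cmod z)\<^sup>2 = l"
    using l by (simp add: z norm_mult)
  ultimately show ?thesis by (simp add: p)
qed

text \<open>The open interval of angles excludes the angle 0, so exactly the nonnegative real axis
  is missed, which is a null set.\<close>

lemma polar_image: "polar ` polar_domain = - ({0..} \<times> {0})"
proof (intro equalityI subsetI)
  fix q assume "q \<in> polar ` polar_domain"
  then obtain p where p: "p \<in> polar_domain" "q = polar p" by blast
  show "q \<in> - ({0..} \<times> {0})"
  proof
    assume "q \<in> {0..} \<times> {0}"
    then have "Arg2pi (Complex (fst q) (snd q)) = 0"
      by (auto simp: Arg2pi_eq_0 complex_is_Real_iff)
    with polar_inverse[OF p(1)] p show False
      by (auto simp: polar_domain_def)
  qed
next
  fix q :: "real \<times> real" assume q: "q \<in> - ({0..} \<times> {0})"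
  define z where "z = Complex (fst q) (snd q)"
  have z: "Arg2pi z \<noteq> 0" "z \<noteq> 0"
    using q by (cases q; auto simp: z_def Arg2pi_eq_0 complex_is_Real_iff Complex_eq_0)+
  have "z = of_real (cmod z) * exp (\<i> * of_real (Arg2pi z))"
    by (rule Arg2pi_eq)
  then have "q = polar ((cmod z)\<^sup>2, Arg2pi z)"
    by (cases q) (auto simp: z_def polar_def complex_eq_iff Re_exp Im_exp)
  moreover have "((cmod z)\<^sup>2, Arg2pi z) \<in> polar_domain"
    using z Arg2pi_ge_0[of z] Arg2pi_lt_2pi[of z] by (auto simp: polar_domain_def less_le)
  ultimately show "q \<in> polar ` polar_domain" by blast
qed

text \<open>Jacobian matrices are taken on \<open>real^2\<close>, whereas the product decomposition
  delivers planes as pairs; \<open>vec2\<close> and \<open>unvec2\<close> translate between the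
  two.\<close>

definition vec2 :: "real \<times> real \<Rightarrow> real^2" where
  "vec2 p = (\<chi> i. if i = 1 then fst p else snd p)"

definition unvec2 :: "real^2 \<Rightarrow> real \<times> real" where
  "unvec2 x = (x $ 1, x $ 2)"

lemma vec2_inverse [simp]: "unvec2 (vec2 p) = p" "vec2 (unvec2 x) = x"
  by (auto simp: vec2_def unvec2_def vec_eq_iff) (metis exhaust_2)

lemma borel_measurable_vec2 [measurable]: "vec2 \<in> borel_measurable borel"
proof -
  have "(\<lambda>p. if i = 1 then fst p else snd p) \<in> borel_measurable (borel :: (real \<times> real) measure)" for i :: 2
    by (cases "i = 1") (auto intro!: borel_measurable_continuous_onI continuous_intros)
  then show ?thesis
    unfolding vec2_def by (rule borel_measurable_vec_lambda)
qed

lemma borel_measurable_unvec2 [measurable]: "unvec2 \<in> borel_measurable borel"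
  unfolding unvec2_def by (intro borel_measurable_continuous_onI continuous_intros)

lemma vec2_image: "vec2 ` S = unvec2 -` S"
  by (auto simp: image_iff) (metis vec2_inverse(2))

lemma vec2_image_borel [measurable (raw)]: "S \<in> sets borel \<Longrightarrow> vec2 ` S \<in> sets borel"
  using measurable_sets[OF borel_measurable_unvec2, of S] by (simp add: vec2_image)

lemma box_Pair: "box (a, b) (c, d) = box a c \<times> box b d"
  by (auto simp: box_def Basis_prod_def ball_Un)

lemma lborel_vec2: "lborel = distr lborel borel vec2"
proof (rule lborel_eqI)
  fix l u :: "real^2" assume le: "\<And>b. b \<in> Basis \<Longrightarrow> l \<bullet> b \<le> u \<bullet> b"
  have le': "l $ i \<le> u $ i" for i
    using le[of "axis i 1"] by (simp add: inner_axis)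
  have "vec2 -` box l u = box (unvec2 l) (unvec2 u)"
    by (auto simp: vec2_def unvec2_def mem_box_cart forall_2 box_Pair)
  then have "emeasure (distr lborel borel vec2) (box l u) = emeasure lborel (box (unvec2 l) (unvec2 u))"
    by (subst emeasure_distr) auto
  also have "\<dots> = (\<Prod>b\<in>Basis. (unvec2 u - unvec2 l) \<bullet> b)"
    using le' by (subst emeasure_lborel_box) (auto simp: unvec2_def Basis_prod_def)
  also have "(\<Prod>b\<in>Basis. (unvec2 u - unvec2 l) \<bullet> b) = (\<Prod>b\<in>Basis. (u - l) \<bullet> b)"
    by (simp add: prod_Basis_prod prod_Basis_cart inner_axis UNIV_2 unvec2_def)
  finally show "emeasure (distr lborel borel vec2) (box l u) = (\<Prod>b\<in>Basis. (u - l) \<bullet> b)" .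
qed simp

lemma emeasure_lborel_vec2:
  assumes [measurable]: "S \<in> sets borel"
  shows "emeasure lborel S = emeasure lborel (vec2 ` S)"
proof -
  have "vec2 -` vec2 ` S = S"
    by (auto simp: image_iff) (metis vec2_inverse(1))
  then show ?thesis
    by (subst lborel_vec2, subst emeasure_distr) auto
qed

text \<open>The Jacobian determinant is constantly 1/2, and \<open>polar\<close> is injective on its
  domain with an image of full measure, so areas double in the preimage. Finiteness of the area puts
  the image into \<open>lmeasurable\<close>.\<close>

lemma emeasure_polar_preimage:
  assumes [measurable]: "B \<in> sets borel" and fin: "emeasure lborel B < \<infinity>"
  shows "emeasure lborel (polar_domain \<inter> polar -` B) = 2 * emeasure lborel B"
proof -
  define g where "g x = vec2 (polar (unvec2 x))" for x
  define g' where "g' x h = (h $ 1 * cos (x $ 2) / (2 * sqrt (x $ 1)) - h $ 2 * sqrt (x $ 1) * sin (x $ 2)) *\<^sub>R axis 1 1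
      + (h $ 1 * sin (x $ 2) / (2 * sqrt (x $ 1)) + h $ 2 * sqrt (x $ 1) * cos (x $ 2)) *\<^sub>R (axis 2 1 :: real^2)"
    for x h :: "real^2"
  have g_eq: "g x = (sqrt (x $ 1) * cos (x $ 2)) *\<^sub>R axis 1 1 + (sqrt (x $ 1) * sin (x $ 2)) *\<^sub>R axis 2 1" for x
    by (simp add: g_def vec2_def unvec2_def polar_def vec_eq_iff forall_2 axis_def)
  define S where "S = polar_domain \<inter> polar -` B"
  have S [measurable]: "S \<in> sets borel"
    unfolding S_def using measurable_sets[OF borel_measurable_polar, of B] by auto
  have T: "vec2 ` S \<in> sets borel"
    by measurable
  have pos: "x $ 1 > 0" if "x \<in> vec2 ` S" for x
    using that by (auto simp: S_def polar_domain_def vec2_def)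
  have nth: "((\<lambda>x. x $ i) has_derivative (\<lambda>h. h $ i)) F" for i :: 2 and F :: "(real^2) filter"
    by (rule bounded_linear_imp_has_derivative[OF bounded_linear_vec_nth])
  have der: "(g has_derivative g' x) (at x within vec2 ` S)" if "x \<in> vec2 ` S" for x
    unfolding g_eq g'_def
    using pos[OF that]
    by (auto intro!: derivative_eq_intros nth simp: field_simps fun_eq_iff)
  have det: "\<bar>det (matrix (g' x))\<bar> = 1 / 2" if "x \<in> vec2 ` S" for x
  proof -
    define s c t where "s = sqrt (x $ 1)" and "c = cos (x $ 2)" and "t = sin (x $ 2)"
    have "s > 0" using pos[OF that] by (simp add: s_def)
    have "det (matrix (g' x)) = c / (2 * s) * (s * c) + (s * t) * (t / (2 * s))"
      unfolding det_2 matrix_def g'_def s_def[symmetric] c_def[symmetric] t_def[symmetric]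
      by (simp add: axis_def)
    also have "\<dots> = (c\<^sup>2 + t\<^sup>2) / 2"
      using \<open>s > 0\<close> by (simp add: field_simps power2_eq_square)
    also have "\<dots> = 1 / 2" by (simp add: c_def t_def)
    finally show ?thesis by simp
  qed
  have inj: "inj_on g (vec2 ` S)"
    by (intro inj_onI) (auto simp: g_def S_def, metis polar_inverse vec2_inverse(1))
  have img: "g ` vec2 ` S = vec2 ` (B - {0..} \<times> {0})"
  proof -
    have "polar ` S = B - {0..} \<times> {0}"
    proof -
      have "polar ` S = B \<inter> polar ` polar_domain" by (auto simp: S_def)
      then show ?thesis unfolding polar_image by auto
    qed
    then show ?thesis by (auto simp: g_def image_image simp flip: \<open>polar ` S = _\<close>)
  qed
  have ray: "{0..} \<times> {0} \<in> null_sets (lborel :: (real \<times> real) measure)"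
  proof (rule null_sets_subset)
    show "UNIV \<times> {0} \<in> null_sets (lborel :: (real \<times> real) measure)"
      by (auto simp: null_sets_def lborel_prod[symmetric] lborel.emeasure_pair_measure_Times)
  qed (auto intro!: borel_closed closed_Times)
  have "emeasure lborel (g ` vec2 ` S) = emeasure lborel (B - {0..} \<times> {0})"
    unfolding img
    by (rule emeasure_lborel_vec2[symmetric], rule sets.Diff) (auto intro!: borel_closed closed_Times)
  also have "\<dots> = emeasure lborel B"
    by (rule emeasure_Diff_null_set[OF ray]) simp
  finally have em: "emeasure lborel (g ` vec2 ` S) = emeasure lborel B" .
  have mimg: "g ` vec2 ` S \<in> sets borel"
    unfolding img
    by (rule vec2_image_borel, rule sets.Diff) (auto intro!: borel_closed closed_Times)
  have "g ` vec2 ` S \<in> lmeasurable"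
    using em fin mimg by (intro fmeasurableI) (auto simp: emeasure_completion)
  \<comment> \<open>The theorem expresses the measure of the image as the integral of the Jacobian
    over the domain. Since the Jacobian is constant, this also yields that the domain has finite
    measure, twice that of the image.\<close>
  then have "((\<lambda>x. \<bar>det (matrix (g' x))\<bar>) has_integral measure lebesgue (g ` vec2 ` S)) (vec2 ` S)"
    using has_measure_differentiable_image[of "vec2 ` S" g g'] T der inj by auto
  then have "((\<lambda>x. 1 / 2 :: real) has_integral measure lebesgue (g ` vec2 ` S)) (vec2 ` S)"
    by (rule has_integral_eq[rotated]) (use det in auto)
  from has_integral_mult_right[OF this, of 2]
  have one: "((\<lambda>x. 1 :: real) has_integral 2 * measure lebesgue (g ` vec2 ` S)) (vec2 ` S)"
    by simp
  then have "vec2 ` S \<in> lmeasurable"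
    by (auto simp: lmeasurable_iff_integrable_on)
  moreover from this have "measure lebesgue (vec2 ` S) = 2 * measure lebesgue (g ` vec2 ` S)"
    by (simp only: lmeasure_integral integral_unique[OF one])
  moreover have L: "emeasure lborel X = ennreal (measure lebesgue X)" if "X \<in> lmeasurable" "X \<in> sets borel" for X :: "(real^2) set"
    using emeasure_eq_measure2[OF that(1)] that(2) by (simp add: emeasure_completion)
  ultimately have "emeasure lborel (vec2 ` S) = 2 * emeasure lborel (g ` vec2 ` S)"
    using L[of "vec2 ` S"] L[of "g ` vec2 ` S"] \<open>g ` vec2 ` S \<in> lmeasurable\<close> T mimg
    by (simp add: ennreal_mult)
  then show ?thesis
    using emeasure_lborel_vec2[OF S] em by (simp add: S_def)
qed

definition polar_vec :: "(real^'n) \<times> (real^'n) \<Rightarrow> (real^'n) \<times> (real^'n)" where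
  "polar_vec z = (\<chi> i. fst (polar (fst z $ i, snd z $ i)), \<chi> i. snd (polar (fst z $ i, snd z $ i)))"

lemma borel_measurable_polar_vec [measurable]: "polar_vec \<in> borel_measurable borel"
proof -
  have "(\<lambda>z. fst (polar (fst z $ i, snd z $ i))) \<in> borel_measurable (borel :: ((real^'n) \<times> (real^'n)) measure)"
    "(\<lambda>z. snd (polar (fst z $ i, snd z $ i))) \<in> borel_measurable (borel :: ((real^'n) \<times> (real^'n)) measure)" for i
    unfolding polar_def by (auto intro!: borel_measurable_continuous_onI continuous_intros)
  then show ?thesis
    unfolding polar_vec_def by (intro borel_measurable_Pair borel_measurable_vec_lambda)
qed

definition polar_domain_vec :: "((real^'n) \<times> (real^'n)) set" where
  "polar_domain_vec = {z. \<forall>i. (fst z $ i, snd z $ i) \<in> polar_domain}"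

lemma polar_domain_vec_measurable [measurable]: "polar_domain_vec \<in> sets borel"
proof -
  have "open (\<Inter>i. (\<lambda>z::(real^'n) \<times> (real^'n). (fst z $ i, snd z $ i)) -` polar_domain)"
    by (intro open_INT ballI open_vimage) (auto simp: polar_domain_def intro!: open_Times continuous_intros)
  also have "(\<Inter>i. (\<lambda>z. (fst z $ i, snd z $ i)) -` polar_domain) = (polar_domain_vec :: ((real^'n) \<times> (real^'n)) set)"
    by (auto simp: polar_domain_vec_def)
  finally show ?thesis by (rule borel_open)
qed

text \<open>After regrouping, a box is a product of planar boxes \<open>B i\<close>. Each plane
  contributes the factor 2 of \<open>emeasure_polar_preimage\<close>, which
  \<open>1 / 2 ^ CARD('n)\<close> compensates.\<close>

lemma lborel_polar_vec:
  "(lborel :: ((real^'n) \<times> (real^'n)) measure) = density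
     (distr (density lborel (indicator polar_domain_vec)) borel polar_vec) (\<lambda>_. ennreal (1 / 2 ^ CARD('n)))"
proof (rule lborel_eqI)
  fix l u :: "(real^'n) \<times> (real^'n)" assume le: "\<And>b. b \<in> Basis \<Longrightarrow> l \<bullet> b \<le> u \<bullet> b"
  define B where "B i = box (fst l $ i, snd l $ i) (fst u $ i, snd u $ i)" for i
  have le': "fst l $ i \<le> fst u $ i" "snd l $ i \<le> snd u $ i" for i
    using le[of "(axis i 1, 0)"] le[of "(0, axis i 1)"]
    by (auto simp: Basis_prod_def inner_prod_def inner_axis Basis_cart_eq_range)
  have B: "emeasure lborel (B i) = ennreal ((fst u $ i - fst l $ i) * (snd u $ i - snd l $ i))" for i
    using le' unfolding B_def
    by (subst emeasure_lborel_box) (auto simp: prod_Basis_prod inner_prod_def Basis_prod_def)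
  have [measurable]: "B i \<in> sets borel" for i by (simp add: B_def)
  have pB [measurable]: "polar_domain \<inter> polar -` B i \<in> sets borel" for i
    using measurable_sets[OF borel_measurable_polar, of "B i"] by auto
  have "polar_vec z \<in> box l u \<longleftrightarrow> (\<forall>i. polar (fst z $ i, snd z $ i) \<in> B i)" for z
  proof -
    have "box l u = box (fst l) (fst u) \<times> box (snd l) (snd u)"
      by (metis box_Pair prod.collapse)
    then show ?thesis
      by (auto simp: polar_vec_def B_def box_Pair mem_box_cart mem_Times_iff)
  qed
  then have ind: "indicator polar_domain_vec z * indicator (box l u) (polar_vec z) =
      (\<Prod>i\<in>UNIV. indicator (polar_domain \<inter> polar -` B i) (fst z $ i, snd z $ i) :: ennreal)" for z
    by (auto simp: indicator_def polar_domain_vec_def prod_eq_1_iff)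
  let ?D = "density lborel (indicator polar_domain_vec) :: ((real^'n) \<times> (real^'n)) measure"
  have "emeasure (density (distr ?D borel polar_vec) (\<lambda>_. ennreal (1 / 2 ^ CARD('n)))) (box l u) =
      (\<integral>\<^sup>+z. ennreal (1 / 2 ^ CARD('n)) * indicator (box l u) z \<partial>distr ?D borel polar_vec)"
    by (subst emeasure_density) auto
  also have "\<dots> = ennreal (1 / 2 ^ CARD('n)) * (\<integral>\<^sup>+z. indicator (box l u) z \<partial>distr ?D borel polar_vec)"
    by (rule nn_integral_cmult) auto
  also have "(\<integral>\<^sup>+z. indicator (box l u) z \<partial>distr ?D borel polar_vec) = (\<integral>\<^sup>+z. indicator (box l u) (polar_vec z) \<partial>?D)"
    by (subst nn_integral_distr) auto
  also have "\<dots> = (\<integral>\<^sup>+z. indicator polar_domain_vec z * indicator (box l u) (polar_vec z) \<partial>lborel)"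
    by (subst nn_integral_density) auto
  also have "\<dots> = (\<Prod>i\<in>UNIV. emeasure lborel (polar_domain \<inter> polar -` B i))"
    unfolding ind by (subst nn_integral_lborel_vec_prod) auto
  also have "\<dots> = (\<Prod>i\<in>UNIV. ennreal (2 * ((fst u $ i - fst l $ i) * (snd u $ i - snd l $ i))))"
    using le' by (subst emeasure_polar_preimage) (auto simp: B ennreal_mult ennreal_mult_less_top)
  also have "ennreal (1 / 2 ^ CARD('n)) * \<dots> =
    ennreal (\<Prod>i\<in>UNIV. (fst u $ i - fst l $ i) * (snd u $ i - snd l $ i))"
    using le' by (simp add: prod_ennreal prod.distrib ennreal_mult[symmetric] prod_nonneg)
  also have "\<dots> = (\<Prod>b\<in>Basis. (u - l) \<bullet> b)"
    by (simp add: prod_Basis_prod inner_prod_def prod_Basis_cart inner_axis prod.distrib)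
  finally show "emeasure (density (distr (density lborel (indicator polar_domain_vec)) borel polar_vec)
      (\<lambda>_. ennreal (1 / 2 ^ CARD('n)))) (box l u) = (\<Prod>b\<in>Basis. (u - l) \<bullet> b)" .
qed simp

lemma
  fixes f :: "(real^'n) \<times> (real^'n) \<Rightarrow> 'b::{banach,second_countable_topology}"
  assumes [measurable]: "f \<in> borel_measurable borel"
  shows integrable_polar_vec:
      "integrable lborel f \<longleftrightarrow> integrable lborel (\<lambda>z. indicat_real polar_domain_vec z *\<^sub>R f (polar_vec z))"
    and integral_polar_vec:
      "integral\<^sup>L lborel f = (1 / 2 ^ CARD('n)) *\<^sub>R (\<integral>z. indicat_real polar_domain_vec z *\<^sub>R f (polar_vec z) \<partial>lborel)"
proof -
  let ?f = "\<lambda>z. indicat_real polar_domain_vec z *\<^sub>R f (polar_vec z)"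
  have ind: "(indicator polar_domain_vec :: ((real^'n) \<times> (real^'n)) \<Rightarrow> ennreal) = (\<lambda>z. ennreal (indicator polar_domain_vec z))"
    by (auto simp: ennreal_indicator)
  have "integrable lborel f \<longleftrightarrow>
      integrable (distr (density lborel (indicator polar_domain_vec)) borel polar_vec) (\<lambda>z. (1 / 2 ^ CARD('n)) *\<^sub>R f z)"
    by (subst lborel_polar_vec) (simp add: integrable_density)
  also have "\<dots> \<longleftrightarrow> integrable (distr (density lborel (indicator polar_domain_vec)) borel polar_vec) f"
    by (rule integrable_scaleR_right_iff) simp
  also have "\<dots> \<longleftrightarrow> integrable (density lborel (indicator polar_domain_vec)) (\<lambda>z. f (polar_vec z))"
    by (subst integrable_distr_eq) auto
  also have "\<dots> \<longleftrightarrow> integrable lborel ?f"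
    unfolding ind by (subst integrable_density) auto
  finally show "integrable lborel f \<longleftrightarrow> integrable lborel ?f" .
  have "integral\<^sup>L lborel f =
      (\<integral>z. (1 / 2 ^ CARD('n)) *\<^sub>R f z \<partial>(distr (density lborel (indicator polar_domain_vec)) borel polar_vec))"
    by (subst lborel_polar_vec) (simp add: integral_density)
  also have "\<dots> = (1 / 2 ^ CARD('n)) *\<^sub>R integral\<^sup>L (distr (density lborel (indicator polar_domain_vec)) borel polar_vec) f"
    by (rule integral_scaleR_right)
  also have "integral\<^sup>L (distr (density lborel (indicator polar_domain_vec)) borel polar_vec) f =
      integral\<^sup>L (density lborel (indicator polar_domain_vec)) (\<lambda>z. f (polar_vec z))"
    by (subst integral_distr) auto
  also have "\<dots> = integral\<^sup>L lborel ?f"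
    unfolding ind by (subst integral_density) auto
  finally show "integral\<^sup>L lborel f = (1 / 2 ^ CARD('n)) *\<^sub>R integral\<^sup>L lborel ?f" .
qed

section \<open>Uniqueness of Laplace transforms\<close>

text \<open>The substitution \<open>u = exp (- x)\<close> sends the orthant into the compact
  \<open>unit_cube\<close> and makes \<open>exp (- (k \<bullet> x))\<close> a monomial in
  \<open>u\<close> when the entries of \<open>k\<close> are natural numbers.\<close>

definition exp_neg :: "real^'n \<Rightarrow> real^'n" where
  "exp_neg x = (\<chi> i. exp (- x $ i))"

definition ln_neg :: "real^'n \<Rightarrow> real^'n" where
  "ln_neg x = (\<chi> i. - ln (x $ i))"

lemma ln_neg_exp_neg [simp]: "ln_neg (exp_neg x) = x"
  by (simp add: ln_neg_def exp_neg_def vec_eq_iff)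

lemma borel_measurable_exp_neg [measurable]: "exp_neg \<in> borel_measurable borel"
  unfolding exp_neg_def by (intro borel_measurable_vec_lambda) measurable

lemma borel_measurable_ln_neg [measurable]: "ln_neg \<in> borel_measurable borel"
  unfolding ln_neg_def by (intro borel_measurable_vec_lambda) measurable

definition unit_cube :: "(real^'n) set" where
  "unit_cube = {u. \<forall>i. 0 \<le> u $ i \<and> u $ i \<le> 1}"

lemma compact_unit_cube: "compact (unit_cube :: (real^'n) set)"
proof -
  have "(unit_cube :: (real^'n) set) = cbox 0 (\<chi> i. 1)"
    by (auto simp: unit_cube_def mem_box_cart)
  then show ?thesis by (metis compact_cbox)
qed

lemma exp_neg_unit_cube: "\<forall>i. 0 \<le> x $ i \<Longrightarrow> exp_neg x \<in> unit_cube"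
  by (simp add: exp_neg_def unit_cube_def)

definition monomial :: "('n::finite \<Rightarrow> nat) \<Rightarrow> real^'n \<Rightarrow> real" where
  "monomial k u = (\<Prod>i\<in>UNIV. u $ i ^ k i)"

lemma monomial_times_nth: "monomial k u * u $ i = monomial (k(i := Suc (k i))) u"
  unfolding monomial_def
  by (subst (1 2) prod.remove[of UNIV i]) (auto intro!: prod.cong)

text \<open>\<open>M\<close> plays the law and \<open>f\<close> the candidate density.
  \<open>f\<close> may change sign, because its positivity is to be derived from the conclusion
  \<open>measure_eq_integral\<close>.\<close>

locale laplace_pair =
  fixes M N :: "(real^'n) measure" and f :: "real^'n \<Rightarrow> real"
  assumes fin: "finite_measure M" and sets_M [measurable_cong]: "sets M = sets borel"
    and sets_N [measurable_cong]: "sets N = sets borel" and int_f: "integrable N f"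
    and supp_M: "AE x in M. \<forall>i. 0 \<le> x $ i"
    and supp_f: "\<And>x. \<not> (\<forall>i. 0 \<le> x $ i) \<Longrightarrow> f x = 0"
    and laplace: "\<And>v. \<forall>i. 0 \<le> v $ i \<Longrightarrow>
      (\<integral>x. exp (- (v \<bullet> x)) \<partial>M) = (\<integral>x. exp (- (v \<bullet> x)) * f x \<partial>N)"
begin

interpretation finite_measure M by (rule fin)

lemma borel_measurable_f [measurable]: "f \<in> borel_measurable borel"
  using borel_measurable_integrable[OF int_f] by measurable

text \<open>Test functions are functions of \<open>u = exp_neg x\<close>. The bound is asked on
  \<open>unit_cube\<close> only, since \<open>M\<close> and \<open>f\<close> live where
  \<open>exp_neg\<close> takes its values there, and polynomials are in general unbounded
  elsewhere.\<close>

definition agree :: "(real^'n \<Rightarrow> real) \<Rightarrow> bool" where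
  "agree h \<longleftrightarrow> h \<in> borel_measurable borel \<and> (\<exists>B. \<forall>u\<in>unit_cube. \<bar>h u\<bar> \<le> B) \<and>
     (\<integral>x. h (exp_neg x) \<partial>M) = (\<integral>x. h (exp_neg x) * f x \<partial>N)"

lemma bounded_imp_integrable:
  assumes [measurable]: "h \<in> borel_measurable borel" and B: "\<And>u. u \<in> unit_cube \<Longrightarrow> \<bar>h u\<bar> \<le> B"
  shows "integrable M (\<lambda>x. h (exp_neg x))" "integrable N (\<lambda>x. h (exp_neg x) * f x)"
proof -
  have "AE x in M. norm (h (exp_neg x)) \<le> B"
    using supp_M by eventually_elim (simp add: B exp_neg_unit_cube)
  then show "integrable M (\<lambda>x. h (exp_neg x))"
    by (rule integrable_const_bound) measurable
  have "norm (h (exp_neg x) * f x) \<le> norm (B * f x)" for x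
  proof (cases "\<forall>i. 0 \<le> x $ i")
    case True
    then have "\<bar>h (exp_neg x)\<bar> \<le> B" by (simp add: B exp_neg_unit_cube)
    then show ?thesis by (auto simp: abs_mult intro!: mult_right_mono)
  qed (simp add: supp_f)
  then show "integrable N (\<lambda>x. h (exp_neg x) * f x)"
    by (intro Bochner_Integration.integrable_bound[OF integrable_mult_right[OF int_f, of B]]) auto
qed

lemma agree_add:
  assumes "agree g" "agree h" shows "agree (\<lambda>u. g u + h u)"
proof -
  obtain B C where B: "\<And>u. u \<in> unit_cube \<Longrightarrow> \<bar>g u\<bar> \<le> B" and C: "\<And>u. u \<in> unit_cube \<Longrightarrow> \<bar>h u\<bar> \<le> C"
    using assms unfolding agree_def by blast
  have m: "g \<in> borel_measurable borel" "h \<in> borel_measurable borel"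
    using assms unfolding agree_def by auto
  have "\<bar>g u + h u\<bar> \<le> B + C" if "u \<in> unit_cube" for u
    using B[OF that] C[OF that] by linarith
  then show ?thesis
    using assms bounded_imp_integrable[OF m(1) B] bounded_imp_integrable[OF m(2) C]
    unfolding agree_def by (auto simp: distrib_right)
qed

lemma agree_cmult:
  assumes "agree h" shows "agree (\<lambda>u. c * h u)"
proof -
  obtain B where B: "\<And>u. u \<in> unit_cube \<Longrightarrow> \<bar>h u\<bar> \<le> B"
    using assms unfolding agree_def by blast
  have "\<bar>c * h u\<bar> \<le> \<bar>c\<bar> * B" if "u \<in> unit_cube" for u
    using B[OF that] by (simp add: abs_mult mult_left_mono)
  then show ?thesis
    using assms unfolding agree_def by (auto simp: mult.assoc)
qed

lemma agree_sum: "finite I \<Longrightarrow> (\<And>i. i \<in> I \<Longrightarrow> agree (h i)) \<Longrightarrow> agree (\<lambda>u. \<Sum>i\<in>I. h i u)"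
proof (induction I rule: finite_induct)
  case empty
  show ?case by (auto simp: agree_def)
qed (simp add: agree_add)

text \<open>Dominated convergence on both sides: the constant \<open>B\<close> is integrable because
  \<open>M\<close> is finite, and \<open>B * f\<close> because \<open>f\<close> is
  integrable.\<close>

lemma agree_limit:
  assumes h: "\<And>n. agree (h n)" and [measurable]: "g \<in> borel_measurable borel"
    and B: "\<And>n u. u \<in> unit_cube \<Longrightarrow> \<bar>h n u\<bar> \<le> B"
    and lim: "\<And>u. u \<in> unit_cube \<Longrightarrow> (\<lambda>n. h n u) \<longlonglongrightarrow> g u"
  shows "agree g"
proof -
  have [measurable]: "h n \<in> borel_measurable borel" for n
    using h unfolding agree_def by auto
  have gB: "\<bar>g u\<bar> \<le> B" if "u \<in> unit_cube" for u
    using tendsto_rabs[OF lim[OF that]] B[OF that] by (intro LIMSEQ_le_const2) auto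
  have "(\<lambda>n. \<integral>x. h n (exp_neg x) \<partial>M) \<longlonglongrightarrow> (\<integral>x. g (exp_neg x) \<partial>M)"
  proof (rule integral_dominated_convergence[where w="\<lambda>_. B"])
    show "AE x in M. (\<lambda>n. h n (exp_neg x)) \<longlonglongrightarrow> g (exp_neg x)"
      using supp_M by eventually_elim (simp add: lim exp_neg_unit_cube)
    show "AE x in M. norm (h n (exp_neg x)) \<le> B" for n
      using supp_M by eventually_elim (simp add: B exp_neg_unit_cube)
  qed auto
  moreover have "(\<lambda>n. \<integral>x. h n (exp_neg x) * f x \<partial>N) \<longlonglongrightarrow> (\<integral>x. g (exp_neg x) * f x \<partial>N)"
  proof (rule integral_dominated_convergence[where w="\<lambda>x. \<bar>B * f x\<bar>"])
    have "(\<lambda>n. h n (exp_neg x) * f x) \<longlonglongrightarrow> g (exp_neg x) * f x" for x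
      by (cases "\<forall>i. 0 \<le> x $ i") (auto simp: supp_f intro!: tendsto_mult lim exp_neg_unit_cube)
    then show "AE x in N. (\<lambda>n. h n (exp_neg x) * f x) \<longlonglongrightarrow> g (exp_neg x) * f x" by simp
    have "norm (h n (exp_neg x) * f x) \<le> \<bar>B * f x\<bar>" for n x
    proof (cases "\<forall>i. 0 \<le> x $ i")
      case True
      then have "\<bar>h n (exp_neg x)\<bar> \<le> B" by (simp add: B exp_neg_unit_cube)
      then show ?thesis by (auto simp: abs_mult intro!: mult_right_mono)
    qed (simp add: supp_f)
    then show "AE x in N. norm (h n (exp_neg x) * f x) \<le> \<bar>B * f x\<bar>" for n by simp
    show "integrable N (\<lambda>x. \<bar>B * f x\<bar>)"
      using int_f by (intro integrable_abs integrable_mult_right)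
  qed auto
  ultimately have "(\<integral>x. g (exp_neg x) \<partial>M) = (\<integral>x. g (exp_neg x) * f x \<partial>N)"
    using h unfolding agree_def by (auto intro: LIMSEQ_unique)
  then show ?thesis using gB unfolding agree_def by auto
qed

text \<open>At \<open>exp_neg x\<close> the monomial is \<open>exp (- (k \<bullet> x))\<close>, so
  this is the hypothesis \<open>laplace\<close> at the lattice point \<open>k\<close>.\<close>

lemma agree_monomial: "agree (monomial k)"
proof -
  have "monomial k (exp_neg x) = exp (- ((\<chi> i. real (k i)) \<bullet> x))" for x
    by (simp add: monomial_def exp_neg_def inner_vec_def exp_sum[symmetric] sum_negf exp_of_nat_mult[symmetric])
  moreover have "\<bar>monomial k u\<bar> \<le> 1" if "u \<in> unit_cube" for u
    using that unfolding monomial_def abs_prod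
    by (intro prod_le_1) (auto simp: unit_cube_def power_le_one)
  moreover have "monomial k \<in> borel_measurable borel"
    unfolding monomial_def by measurable
  ultimately show ?thesis
    unfolding agree_def using laplace[of "\<chi> i. real (k i)"] by auto
qed

text \<open>
  Polynomials are not given as combinations of monomials; generalizing over \<open>g\<close> lets the
  induction pass through products.
\<close>

lemma agree_monomial_polynomial_mult:
  assumes "real_polynomial_function p" "\<And>k. agree (\<lambda>u. monomial k u * g u)"
  shows "agree (\<lambda>u. monomial k u * (p u * g u))"
  using assms
proof (induction arbitrary: g k)
  case (linear p)
  \<comment> \<open>A linear functional is a combination of coordinates, and a coordinate factor
    only raises one exponent of the monomial.\<close>
  have p: "p u = (\<Sum>i\<in>UNIV. p (axis i 1) * u $ i)" for u
  proof -
    have "u = (\<Sum>i\<in>UNIV. u $ i *\<^sub>R axis i 1)"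
      by (simp add: vec_eq_iff axis_def if_distrib cong: if_cong)
    then have "p u = p (\<Sum>i\<in>UNIV. u $ i *\<^sub>R axis i 1)" by simp
    also have "\<dots> = (\<Sum>i\<in>UNIV. p (axis i 1) * u $ i)"
      using linear(1) by (simp add: bounded_linear.linear linear_sum linear_scale mult.commute)
    finally show ?thesis .
  qed
  have "agree (\<lambda>u. \<Sum>i\<in>UNIV. p (axis i 1) * (monomial (k(i := Suc (k i))) u * g u))"
    by (intro agree_sum agree_cmult linear) auto
  then show ?case
    by (subst p) (simp add: monomial_times_nth[symmetric] sum_distrib_left sum_distrib_right mult_ac)
next
  case (const c)
  then show ?case using agree_cmult[of "\<lambda>u. monomial k u * g u" c] by (simp add: mult_ac)
next
  case (add p q)
  then show ?case using agree_add[OF add.IH(1)[of g k] add.IH(2)[of g k]] by (simp add: algebra_simps)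
next
  case (mult p q)
  have "agree (\<lambda>u. monomial k u * (p u * (q u * g u)))"
    by (rule mult.IH(1)) (rule mult.IH(2), rule mult.prems)
  then show ?case by (simp add: mult_ac)
qed

lemma agree_polynomial:
  assumes "real_polynomial_function p" shows "agree p"
proof -
  have "agree (\<lambda>u. monomial k u * 1)" for k
    by (simp add: agree_monomial)
  \<comment> \<open>With all exponents 0 the monomial is the constant 1.\<close>
  from agree_monomial_polynomial_mult[OF assms this, of "\<lambda>_. 0"] show ?thesis
    by (simp add: monomial_def)
qed

text \<open>Stone-Weierstrass on the compact cube gives uniform polynomial approximations; their
  errors stay below 1, so \<open>B + 1\<close> bounds them all and \<open>agree_limit\<close>
  applies.\<close>

lemma agree_continuous:
  assumes "continuous_on UNIV h" shows "agree h"
proof -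
  have h: "continuous_on unit_cube h"
    using assms continuous_on_subset by blast
  have "\<exists>p. real_polynomial_function p \<and> (\<forall>u\<in>unit_cube. \<bar>h u - p u\<bar> < 1 / Suc n)" for n
    using Stone_Weierstrass_real_polynomial_function[OF compact_unit_cube h, of "1 / Suc n"]
    by (metis of_nat_0_less_iff zero_less_Suc zero_less_divide_1_iff)
  then obtain p where p: "\<And>n. real_polynomial_function (p n)"
    "\<And>n u. u \<in> unit_cube \<Longrightarrow> \<bar>h u - p n u\<bar> < 1 / Suc n"
    by metis
  obtain B where B: "\<And>u. u \<in> unit_cube \<Longrightarrow> \<bar>h u\<bar> \<le> B"
    using compact_imp_bounded[OF compact_continuous_image[OF h compact_unit_cube]]
    by (auto simp: bounded_iff)
  show ?thesis
  proof (rule agree_limit[where h=p and B="B + 1"])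
    show "\<bar>p n u\<bar> \<le> B + 1" if "u \<in> unit_cube" for n u
    proof -
      have "1 / real (Suc n) \<le> 1" by simp
      with p(2)[OF that, of n] B[OF that] show ?thesis by linarith
    qed
    show "(\<lambda>n. p n u) \<longlonglongrightarrow> h u" if "u \<in> unit_cube" for u
    proof (rule LIMSEQ_I)
      fix e :: real assume "e > 0"
      then obtain m where "1 / Suc m < e"
        using nat_approx_posE by blast
      moreover have "1 / real (Suc n) \<le> 1 / Suc m" if "n \<ge> m" for n
        using that by (simp add: frac_le)
      ultimately have "norm (p n u - h u) < e" if "n \<ge> m" for n
        using p(2)[OF \<open>u \<in> unit_cube\<close>, of n] that by (force simp: abs_minus_commute)
      then show "\<exists>m. \<forall>n\<ge>m. norm (p n u - h u) < e" by blast
    qed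
  qed (use assms p in \<open>auto intro!: agree_polynomial borel_measurable_continuous_onI\<close>)
qed

lemma agree_closed:
  assumes "closed C" shows "agree (indicator C)"
\<comment> \<open>\<open>infdist\<close> to the empty set is 0 by convention, so the functions
  \<open>h n\<close> would be constantly 1 there instead of tending to the indicator.\<close>
proof (cases "C = {}")
  case False
  define h where "h n u = max 0 (1 - real n * infdist u C)" for n u
  show ?thesis
  proof (rule agree_limit[where h=h and B=1])
    show "agree (h n)" for n
      unfolding h_def by (intro agree_continuous continuous_intros)
    show "\<bar>h n u\<bar> \<le> 1" for n u
      by (simp add: h_def infdist_nonneg)
    show "(\<lambda>n. h n u) \<longlonglongrightarrow> indicator C u" for u
    proof (cases "u \<in> C")
      case True
      then show ?thesis by (simp add: h_def)
    next
      case nC: False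
      then have pos: "infdist u C > 0"
        using assms False by (metis in_closed_iff_infdist_zero infdist_nonneg less_le)
      obtain m where m: "1 < real m * infdist u C"
        using reals_Archimedean3[OF pos] by blast
      have "h n u = 0" if "n \<ge> m" for n
      proof -
        have "real m * infdist u C \<le> real n * infdist u C"
          using that pos by (intro mult_right_mono) auto
        then show ?thesis using m by (simp add: h_def)
      qed
      then have "\<forall>\<^sub>F n in sequentially. h n u = indicator C u"
        using nC eventually_sequentially by auto
      then show ?thesis by (rule tendsto_eventually)
    qed
  qed (use assms in auto)
qed (auto simp: agree_def)

text \<open>Dynkin's argument from the intersection-stable closed sets: complements use the constant
  1 and linearity, disjoint unions use finite sums and \<open>agree_limit\<close>.\<close>

lemma agree_borel:
  assumes "S \<in> sets borel" shows "agree (indicator S)"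
proof -
  have "Int_stable (Collect closed :: (real^'n) set set)" "Collect closed \<subseteq> Pow (UNIV :: (real^'n) set)"
    by (auto simp: Int_stable_def)
  moreover have "S \<in> sigma_sets UNIV (Collect closed)"
    using assms unfolding borel_eq_closed by simp
  ultimately show ?thesis
  proof (induction rule: sigma_sets_induct_disjoint)
    case (compl A)
    have "agree (\<lambda>u. 1 + (-1) * indicator A u)"
      by (intro agree_add agree_cmult compl agree_continuous continuous_intros)
    moreover have "(\<lambda>u. 1 + (-1) * indicator A u :: real) = indicator (UNIV - A)"
      by (auto simp: indicator_def)
    ultimately show ?case by simp
  next
    case (union A)
    have "A i \<in> sets borel" for i
      using union(2) unfolding borel_eq_closed by auto
    then have [measurable]: "(\<Union>i. A i) \<in> sets borel" by auto
    show ?case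
    proof (rule agree_limit[where h="\<lambda>n u. indicator (\<Union>i<n. A i) u" and B=1])
      fix n
      have "agree (\<lambda>u. \<Sum>i<n. indicator (A i) u)"
        by (intro agree_sum union) auto
      moreover have "(\<lambda>u. \<Sum>i<n. indicator (A i) u) = (indicator (\<Union>i<n. A i) :: _ \<Rightarrow> real)"
        using union(1) by (auto simp: indicator_UN_disjoint disjoint_family_on_def)
      ultimately show "agree (indicator (\<Union>i<n. A i))" by simp
    next
      show "(\<lambda>n. indicator (\<Union>i<n. A i) u) \<longlonglongrightarrow> (indicator (\<Union>i. A i) u :: real)" for u
        by (rule LIMSEQ_indicator_UN)
    next
      show "indicator (\<Union>i. A i) \<in> borel_measurable borel"
        by (rule borel_measurable_indicator) fact
    qed (auto simp: indicator_def)
  qed (auto simp: agree_closed, auto simp: agree_def)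
qed

text \<open>Because \<open>ln_neg\<close> undoes \<open>exp_neg\<close>, the indicator of
  \<open>S\<close> at \<open>x\<close> is the indicator of the preimage of \<open>S\<close> under
  \<open>ln_neg\<close>, taken at \<open>exp_neg x\<close>; this is a test function covered by
  \<open>agree_borel\<close>.\<close>

theorem measure_eq_integral:
  assumes [measurable]: "S \<in> sets borel"
  shows "measure M S = (\<integral>x. indicator S x * f x \<partial>N)"
proof -
  have "ln_neg -` S \<in> sets borel"
    using measurable_sets[OF borel_measurable_ln_neg assms] by simp
  from agree_borel[OF this] have "(\<integral>x. indicator (ln_neg -` S) (exp_neg x) \<partial>M) =
      (\<integral>x. indicator (ln_neg -` S) (exp_neg x) * f x \<partial>N)"
    by (simp add: agree_def)
  moreover have "indicator (ln_neg -` S) (exp_neg x) = (indicator S x :: real)" for x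
    by (simp add: indicator_def)
  moreover have "S \<in> sets M" by (simp add: sets_M)
  ultimately show ?thesis
    by (simp add: sets_eq_imp_space_eq[OF sets_M])
qed

end

section \<open>Permanental vectors\<close>

lemma herm_eq_sum:
  "herm A z = (\<Sum>i\<in>UNIV. \<Sum>j\<in>UNIV. of_real (A $ i $ j) *
     (Complex (fst z $ i) (snd z $ i) * cnj (Complex (fst z $ j) (snd z $ j))))"
  by (simp add: herm_def complex_eq_iff inner_vec_def matrix_vector_mult_def sum_distrib_left sum_distrib_right
      sum.distrib[symmetric] sum_subtractf[symmetric] algebra_simps)

lemma cnj_herm: "cnj (herm A (x, y)) = herm A (x, - y)"
  by (simp add: herm_def complex_eq_iff inner_minus_left inner_minus_right
      linear_neg[OF matrix_vector_mul_linear])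

lemma herm_add: "herm (A + B) z = herm A z + herm B z"
  by (simp add: herm_def matrix_vector_mult_add_rdistrib inner_add_right algebra_simps)

lemma polar_vec_eq:
  "polar_vec (l, \<theta>) = (\<chi> i. sqrt (l $ i) * cos (\<theta> $ i), \<chi> i. sqrt (l $ i) * sin (\<theta> $ i))"
  by (simp add: polar_vec_def polar_def)

lemma herm_polar_vec:
  assumes "l \<in> nonneg_orthant"
  shows "herm A (polar_vec (l, \<theta>)) = (\<Sum>i\<in>UNIV. \<Sum>j\<in>UNIV.
    complex_of_real (A $ i $ j * sqrt (l $ i * l $ j)) * exp (\<i> * complex_of_real (\<theta> $ i - \<theta> $ j)))"
proof -
  have "Complex (sqrt (l $ i) * cos (\<theta> $ i)) (sqrt (l $ i) * sin (\<theta> $ i)) *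
      cnj (Complex (sqrt (l $ j) * cos (\<theta> $ j)) (sqrt (l $ j) * sin (\<theta> $ j))) =
      of_real (sqrt (l $ i * l $ j)) * exp (\<i> * complex_of_real (\<theta> $ i - \<theta> $ j))" for i j
    by (simp add: complex_eq_iff Re_exp Im_exp cos_diff sin_diff real_sqrt_mult algebra_simps)
  then show ?thesis
    by (simp add: herm_eq_sum polar_vec_eq mult.assoc)
qed

lemma diag_mat_mult_nth: "(diag_mat v *v x) $ i = v $ i * x $ i"
  unfolding diag_mat_def matrix_vector_mult_def
  by (simp add: if_distrib[of "\<lambda>a. a * b" for b] cong: if_cong)

text \<open>A diagonal form sees only the squared moduli \<open>l $ i\<close> and no phases. Hence
  adding \<open>diag_mat v\<close> to the matrix multiplies the Gaussian integrand by the Laplace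
  factor \<open>exp (- (v \<bullet> l))\<close>.\<close>

lemma herm_diag_mat_polar_vec:
  assumes "l \<in> nonneg_orthant"
  shows "herm (diag_mat v) (polar_vec (l, \<theta>)) = of_real (v \<bullet> l)"
proof -
  have eq: "(sqrt (l $ i) * cos (\<theta> $ i)) * (v $ i * (sqrt (l $ i) * cos (\<theta> $ i))) +
      (sqrt (l $ i) * sin (\<theta> $ i)) * (v $ i * (sqrt (l $ i) * sin (\<theta> $ i))) = v $ i * l $ i" for i
  proof -
    have "(sqrt (l $ i) * cos (\<theta> $ i)) * (v $ i * (sqrt (l $ i) * cos (\<theta> $ i))) +
      (sqrt (l $ i) * sin (\<theta> $ i)) * (v $ i * (sqrt (l $ i) * sin (\<theta> $ i))) =
      v $ i * (sqrt (l $ i))\<^sup>2 * ((cos (\<theta> $ i))\<^sup>2 + (sin (\<theta> $ i))\<^sup>2)"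
      by (simp only: power2_eq_square distrib_left mult_ac)
    also have "\<dots> = v $ i * l $ i"
      using assms by (simp add: nonneg_orthant_def)
    finally show ?thesis .
  qed
  let ?p = "polar_vec (l, \<theta>)"
  have "fst ?p \<bullet> (diag_mat v *v fst ?p) + snd ?p \<bullet> (diag_mat v *v snd ?p) = v \<bullet> l"
    by (simp only: polar_vec_eq fst_conv snd_conv inner_vec_def diag_mat_mult_nth vec_lambda_beta
        inner_real_def sum.distrib[symmetric] eq)
  moreover have "snd ?p \<bullet> (diag_mat v *v fst ?p) = fst ?p \<bullet> (diag_mat v *v snd ?p)"
    by (simp add: inner_vec_def diag_mat_mult_nth mult_ac)
  ultimately show ?thesis by (simp only: herm_def) simp
qed

lemma
  fixes G :: "real^'n^'n"
  assumes "invertible G"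
  shows mult_matrix_inv_right: "G ** matrix_inv G = mat 1"
    and mult_matrix_inv_left: "matrix_inv G ** G = mat 1"
  using someI_ex[OF assms[unfolded invertible_def]] by (simp_all add: matrix_inv_def)

text \<open>With \<open>y = matrix_inv G *v x\<close> the form equals
  \<open>y \<bullet> (G *v y)\<close>, and \<open>y\<close> is nonzero because
  \<open>G *v y = x\<close>.\<close>

lemma positive_form_matrix_inv:
  fixes G :: "real^'n^'n"
  assumes pos: "\<And>x. x \<noteq> 0 \<Longrightarrow> 0 < x \<bullet> (G *v x)" and "x \<noteq> 0"
  shows "0 < x \<bullet> (matrix_inv G *v x)"
proof -
  have "invertible G"
    using det_pos_of_positive_form[OF pos] by (simp add: invertible_det_nz)
  then have "G *v (matrix_inv G *v x) = x"
    by (simp add: matrix_vector_mul_assoc mult_matrix_inv_right)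
  moreover from this have "matrix_inv G *v x \<noteq> 0"
    using \<open>x \<noteq> 0\<close> by auto
  ultimately show ?thesis
    using pos[of "matrix_inv G *v x"] by (simp add: inner_commute)
qed

lemma det_matrix_inv_add_diag_mat:
  fixes G :: "real^'n^'n"
  assumes "invertible G"
  shows "det (mat 1 + diag_mat v ** G) = det (matrix_inv G + diag_mat v) * det G"
proof -
  have "(matrix_inv G + diag_mat v) ** G = mat 1 + diag_mat v ** G"
    by (simp add: mult_matrix_inv_left[OF assms, symmetric])
      (simp add: matrix_matrix_mult_def vec_eq_iff distrib_right sum.distrib)
  then show ?thesis by (metis det_mul)
qed

lemma integral_lborel_reflect:
  fixes h :: "'a::euclidean_space \<Rightarrow> 'b::{banach,second_countable_topology}"
  assumes [measurable]: "h \<in> borel_measurable borel"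
  shows "(\<integral>x. h (t - x) \<partial>lborel) = integral\<^sup>L lborel h"
proof -
  have "integral\<^sup>L lborel h = integral\<^sup>L (distr lborel borel (\<lambda>x. t + (-1) *\<^sub>R x)) h"
    by (subst lborel_affine[of "-1" t]) (simp_all add: density_1)
  then show ?thesis by (simp add: integral_distr)
qed

section \<open>The angular integral and its Laplace transform\<close>

definition angle_box :: "(real^'n) set" where
  "angle_box = {\<theta>. \<forall>i. 0 < \<theta> $ i \<and> \<theta> $ i < 2 * pi}"

definition pos_orthant :: "(real^'n) set" where
  "pos_orthant = {l. \<forall>i. 0 < l $ i}"

lemma angle_box_eq_box: "angle_box = box 0 (\<chi> i. 2 * pi)"
  by (auto simp: angle_box_def mem_box_cart)

lemma angle_box_measurable [measurable]: "angle_box \<in> sets borel"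
  by (simp add: angle_box_eq_box)

lemma open_pos_orthant: "open (pos_orthant :: (real^'n) set)"
proof -
  have "open (\<Inter>i. {l :: real^'n. 0 < l $ i})"
    by (intro open_INT ballI open_Collect_less continuous_intros) auto
  also have "(\<Inter>i. {l :: real^'n. 0 < l $ i}) = pos_orthant" by (auto simp: pos_orthant_def)
  finally show ?thesis .
qed

lemma pos_orthant_measurable [measurable]: "pos_orthant \<in> sets borel"
  by (intro borel_open open_pos_orthant)

lemma indicator_polar_domain_vec:
  "indicator polar_domain_vec (l, \<theta>) = (indicator pos_orthant l * indicator angle_box \<theta> :: real)"
  by (auto simp: indicator_def polar_domain_vec_def polar_domain_def pos_orthant_def angle_box_def)

lemma nonneg_orthant_measurable [measurable]: "(nonneg_orthant :: (real^'n) set) \<in> sets borel"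
proof -
  have "closed (\<Inter>i. {l :: real^'n. 0 \<le> l $ i})"
    by (intro closed_INT ballI closed_Collect_le continuous_intros)
  also have "(\<Inter>i. {l :: real^'n. 0 \<le> l $ i}) = nonneg_orthant" by (auto simp: nonneg_orthant_def)
  finally show ?thesis by (rule borel_closed)
qed

text \<open>Polar coordinates reach only the open orthant, while the density is claimed on the
  closed one; the difference lies in the coordinate hyperplanes, which are null.\<close>

lemma AE_pos_orthant: "AE l in (lborel :: (real^'n) measure). l \<in> nonneg_orthant \<longrightarrow> l \<in> pos_orthant"
proof -
  have "AE l in (lborel :: (real^'n) measure). l $ i \<noteq> 0" for i
  proof -
    have "{l :: real^'n. l $ i = 0} \<in> null_sets lborel"
      using negligible_standard_hyperplane_cart[of i]
      by (simp add: negligible_iff_null_sets null_sets_completion_iff)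
    from AE_not_in[OF this] show ?thesis by simp
  qed
  then have "AE l in (lborel :: (real^'n) measure). \<forall>i. l $ i \<noteq> 0" by (simp add: AE_all_countable)
  then show ?thesis
    by eventually_elim (auto simp: nonneg_orthant_def pos_orthant_def less_le dest: not_sym)
qed

locale positive_kernel =
  fixes W :: "real^'n^'n"
  assumes pos: "\<And>x. x \<noteq> 0 \<Longrightarrow> 0 < x \<bullet> (W *v x)"
begin

text \<open>The unnormalized density: with \<open>W = matrix_inv G\<close> it remains to divide by
  \<open>(2 * pi) ^ CARD('n) * det G\<close>.\<close>

definition phase_integral :: "real^'n \<Rightarrow> complex" where
  "phase_integral l = (\<integral>\<theta>. indicator angle_box \<theta> *\<^sub>R exp (- herm W (polar_vec (l, \<theta>))) \<partial>lborel)"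

lemma norm_exp_herm_le_1: "norm (exp (- herm W z)) \<le> 1"
proof -
  have "0 \<le> x \<bullet> (W *v x)" for x
    using pos[of x] by (cases "x = 0") auto
  from this[of "fst z"] this[of "snd z"] show ?thesis by (simp add: herm_def)
qed

text \<open>Positivity of the form bounds the integrand by 1, so the indicator of the bounded angle
  box dominates. Continuity holds on all of \<open>UNIV\<close> because the total function
  \<open>sqrt\<close> is continuous at negative arguments too.\<close>

lemma continuous_on_phase_integral: "continuous_on UNIV phase_integral"
proof (rule continuous_on_sequentiallyI)
  fix u :: "nat \<Rightarrow> real^'n" and l assume lim: "u \<longlonglongrightarrow> l"
  have "integrable lborel (indicator angle_box :: real^'n \<Rightarrow> real)"
    by (intro integrable_real_indicator emeasure_bounded_finite) (simp_all add: angle_box_eq_box)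
  then show "(\<lambda>n. phase_integral (u n)) \<longlonglongrightarrow> phase_integral l"
    unfolding phase_integral_def
  proof (rule integral_dominated_convergence[rotated 2])
    have "(\<lambda>n. exp (- herm W (polar_vec (u n, \<theta>)))) \<longlonglongrightarrow> exp (- herm W (polar_vec (l, \<theta>)))" for \<theta>
    proof -
      have "continuous_on UNIV (\<lambda>l. exp (- herm W (polar_vec (l, \<theta>))))"
        unfolding polar_vec_eq by (intro continuous_intros)
      then show ?thesis using lim continuous_on_tendsto_compose by fastforce
    qed
    then show "AE \<theta> in lborel. (\<lambda>n. indicat_real angle_box \<theta> *\<^sub>R exp (- herm W (polar_vec (u n, \<theta>))))
        \<longlonglongrightarrow> indicat_real angle_box \<theta> *\<^sub>R exp (- herm W (polar_vec (l, \<theta>)))"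
      by (intro AE_I2 tendsto_scaleR tendsto_const)
    show "AE \<theta> in lborel. norm (indicat_real angle_box \<theta> *\<^sub>R exp (- herm W (polar_vec (u n, \<theta>)))) \<le> indicator angle_box \<theta>" for n
      using norm_exp_herm_le_1 by (intro AE_I2) (auto simp: indicator_def)
  qed auto
qed

text \<open>Replacing each angle by \<open>2 * pi\<close> minus itself preserves the box and
  conjugates all the complex coordinates, hence the integrand, since \<open>W\<close> is
  real.\<close>

lemma phase_integral_real: "complex_of_real (Re (phase_integral l)) = phase_integral l"
proof -
  let ?h = "\<lambda>\<theta>. indicat_real angle_box \<theta> *\<^sub>R exp (- herm W (polar_vec (l, \<theta>)))"
  have "?h ((\<chi> i. 2 * pi) - \<theta>) = cnj (?h \<theta>)" for \<theta>
  proof -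
    have "polar_vec (l, (\<chi> i. 2 * pi) - \<theta>) = (fst (polar_vec (l, \<theta>)), - snd (polar_vec (l, \<theta>)))"
      by (simp add: polar_vec_eq vec_eq_iff cos_diff sin_diff)
    moreover have "indicat_real angle_box ((\<chi> i. 2 * pi) - \<theta>) = indicator angle_box \<theta>"
      by (auto simp: angle_box_def indicator_def)
    ultimately show ?thesis
      by (simp add: cnj_herm[symmetric] exp_cnj)
  qed
  then have "(\<integral>\<theta>. ?h ((\<chi> i. 2 * pi) - \<theta>) \<partial>lborel) = (\<integral>\<theta>. cnj (?h \<theta>) \<partial>lborel)"
    by (intro Bochner_Integration.integral_cong refl)
  also have "\<dots> = cnj (phase_integral l)"
    unfolding phase_integral_def by (rule Bochner_Integration.integral_cnj)
  finally have "(\<integral>\<theta>. ?h ((\<chi> i. 2 * pi) - \<theta>) \<partial>lborel) = cnj (phase_integral l)" .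
  moreover have "(\<integral>\<theta>. ?h ((\<chi> i. 2 * pi) - \<theta>) \<partial>lborel) = phase_integral l"
    unfolding phase_integral_def by (rule integral_lborel_reflect) measurable
  ultimately show ?thesis
    by (simp add: complex_eq_iff)
qed

lemma positive_form_add_diag_mat:
  assumes "v \<in> nonneg_orthant" "x \<noteq> 0"
  shows "0 < x \<bullet> ((W + diag_mat v) *v x)"
proof -
  have "0 \<le> x \<bullet> (diag_mat v *v x)"
    unfolding inner_vec_def diag_mat_mult_nth
    using assms by (intro sum_nonneg) (auto simp: nonneg_orthant_def mult.left_commute)
  then show ?thesis
    using pos[OF assms(2)] by (simp add: matrix_vector_mult_add_rdistrib inner_add_right)
qed

lemma det_add_diag_mat_pos: "v \<in> nonneg_orthant \<Longrightarrow> 0 < det (W + diag_mat v)"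
  by (intro det_pos_of_positive_form positive_form_add_diag_mat)

text \<open>The Gaussian integral for \<open>W + diag_mat v\<close> is written in polar coordinates
  and the angles are integrated first. The constant collects \<open>pi ^ CARD('n)\<close> from the
  Gaussian and \<open>2 ^ CARD('n)\<close> from the Jacobian.\<close>

lemma
  assumes v: "v \<in> nonneg_orthant"
  shows integrable_laplace_phase_integral:
      "integrable lborel (\<lambda>l. exp (- (v \<bullet> l)) * (indicator pos_orthant l * Re (phase_integral l)))"
    and integral_laplace_phase_integral:
      "(\<integral>l. exp (- (v \<bullet> l)) * (indicator pos_orthant l * Re (phase_integral l)) \<partial>lborel) =
        (2 * pi) ^ CARD('n) / det (W + diag_mat v)"
proof -
  define A where "A = W + diag_mat v"
  have A: "0 < x \<bullet> (A *v x)" if "x \<noteq> 0" for x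
    unfolding A_def using v that by (rule positive_form_add_diag_mat)
  define h where "h l \<theta> = indicat_real polar_domain_vec (l, \<theta>) *\<^sub>R exp (- herm A (polar_vec (l, \<theta>)))" for l \<theta>
  have h: "h l \<theta> = (exp (- (v \<bullet> l)) * indicator pos_orthant l) *\<^sub>R
      (indicator angle_box \<theta> *\<^sub>R exp (- herm W (polar_vec (l, \<theta>))))" for l \<theta>
  proof (cases "l \<in> pos_orthant")
    case True
    then have "l \<in> nonneg_orthant" by (auto simp: pos_orthant_def nonneg_orthant_def less_imp_le)
    then have "exp (- herm A (polar_vec (l, \<theta>))) = of_real (exp (- (v \<bullet> l))) * exp (- herm W (polar_vec (l, \<theta>)))"
      by (simp add: A_def herm_add herm_diag_mat_polar_vec exp_of_real[symmetric] exp_add[symmetric] algebra_simps)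
    then show ?thesis
      by (simp add: h_def indicator_polar_domain_vec scaleR_conv_of_real mult_ac)
  qed (simp add: h_def indicator_polar_domain_vec)
  have [measurable]: "(\<lambda>z. exp (- herm A z)) \<in> borel_measurable borel"
    by measurable
  \<comment> \<open>Integrability on the product, inherited from the Gaussian through the polar
    change of variables, justifies Fubini below.\<close>
  have int: "integrable (lborel \<Otimes>\<^sub>M lborel) (case_prod h)"
    using integrable_exp_herm[OF A] integrable_polar_vec[of "\<lambda>z. exp (- herm A z)"]
    by (simp add: lborel_prod h_def split_def)
  have inner: "(\<integral>\<theta>. h l \<theta> \<partial>lborel) =
      complex_of_real (exp (- (v \<bullet> l)) * (indicator pos_orthant l * Re (phase_integral l)))" for l
  proof -
    have "(\<integral>\<theta>. h l \<theta> \<partial>lborel) = (exp (- (v \<bullet> l)) * indicator pos_orthant l) *\<^sub>R phase_integral l"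
      unfolding h phase_integral_def by (rule integral_scaleR_right)
    also have "\<dots> = (exp (- (v \<bullet> l)) * indicator pos_orthant l) *\<^sub>R complex_of_real (Re (phase_integral l))"
      by (simp only: phase_integral_real)
    finally show ?thesis by (simp add: scaleR_conv_of_real mult_ac)
  qed
  have "integrable lborel (\<lambda>l. \<integral>\<theta>. h l \<theta> \<partial>lborel)"
    using lborel_pair.integrable_fst[OF int] .
  then show "integrable lborel (\<lambda>l. exp (- (v \<bullet> l)) * (indicator pos_orthant l * Re (phase_integral l)))"
    unfolding inner by (drule_tac integrable_Re) simp
  have "complex_of_real (pi ^ CARD('n) / det A) = (1 / 2 ^ CARD('n)) *\<^sub>R integral\<^sup>L lborel (case_prod h)"
    using integral_exp_herm[OF A] integral_polar_vec[of "\<lambda>z. exp (- herm A z)"]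
    by (simp add: h_def split_def)
  also have "integral\<^sup>L lborel (case_prod h) = (\<integral>l. \<integral>\<theta>. h l \<theta> \<partial>lborel \<partial>lborel)"
    using lborel_pair.integral_fst[OF int] by (simp add: lborel_prod)
  also have "\<dots> = complex_of_real (\<integral>l. exp (- (v \<bullet> l)) * (indicator pos_orthant l * Re (phase_integral l)) \<partial>lborel)"
    unfolding inner by (rule integral_complex_of_real)
  finally have "complex_of_real (pi ^ CARD('n) / det A) = complex_of_real
      ((\<integral>l. exp (- (v \<bullet> l)) * (indicator pos_orthant l * Re (phase_integral l)) \<partial>lborel) / 2 ^ CARD('n))"
    by (simp add: scaleR_conv_of_real)
  then have "pi ^ CARD('n) / det A =
      (\<integral>l. exp (- (v \<bullet> l)) * (indicator pos_orthant l * Re (phase_integral l)) \<partial>lborel) / 2 ^ CARD('n)"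
    by (simp only: of_real_eq_iff)
  then show "(\<integral>l. exp (- (v \<bullet> l)) * (indicator pos_orthant l * Re (phase_integral l)) \<partial>lborel) =
        (2 * pi) ^ CARD('n) / det (W + diag_mat v)"
    unfolding A_def[symmetric] by (simp add: field_simps power_mult_distrib)
qed

end

section \<open>Identification of the law of the permanental vector\<close>

lemma inner_symmetric_part: "x \<bullet> (symmetric_part G *v x) = x \<bullet> (G *v x)"
proof -
  have "x \<bullet> (transpose G *v x) = x \<bullet> (G *v x)"
    by (metis dot_lmul_matrix inner_commute transpose_matrix_vector)
  then show ?thesis
    by (simp add: symmetric_part_def matrix_vector_mult_add_rdistrib scaleR_matrix_vector_assoc[symmetric] inner_add_right)
qed

text \<open>The law of \<open>X\<close> and \<open>\<rho>\<close> on the open orthant have the same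
  Laplace transform, so \<open>laplace_pair\<close> identifies them on Borel sets. Nonnegativity has
  to be settled before the density is read through \<open>ennreal\<close>, which sends negative
  values to 0.\<close>

lemma permanental_density:
  fixes G :: "real^'n^'n"
  assumes posG: "\<And>x. x \<noteq> 0 \<Longrightarrow> 0 < x \<bullet> (G *v x)"
    and perm: "permanental_vector 1 G M X"
    and \<rho>_def: "\<And>l. \<rho> l = Re (positive_kernel.phase_integral (matrix_inv G) l) / ((2 * pi) ^ CARD('n) * det G)"
  shows "\<forall>l\<in>nonneg_orthant. 0 \<le> \<rho> l"
    and "distributed M (restrict_space lborel nonneg_orthant) X (\<lambda>l. ennreal (\<rho> l))"
proof -
  interpret positive_kernel "matrix_inv G"
    by unfold_locales (rule positive_form_matrix_inv[OF posG])
  have detG: "0 < det G" using posG by (rule det_pos_of_positive_form)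
  then have inv: "invertible G" by (simp add: invertible_det_nz)
  interpret prob_space M using perm by (simp add: permanental_vector_def)
  have X: "X \<in> measurable M (restrict_space borel nonneg_orthant)"
    using perm by (simp add: permanental_vector_def)
  then have [measurable]: "X \<in> borel_measurable M" and X_nonneg: "\<And>\<omega>. \<omega> \<in> space M \<Longrightarrow> X \<omega> \<in> nonneg_orthant"
    by (auto simp: measurable_restrict_space2_iff)
  have cont: "continuous_on UNIV \<rho>"
    unfolding \<rho>_def by (intro continuous_intros continuous_on_phase_integral) (use detG in auto)
  then have [measurable]: "\<rho> \<in> borel_measurable borel"
    by (rule borel_measurable_continuous_onI)
  \<comment> \<open>Values of \<open>\<rho>\<close> off the orthant are artefacts of the total
    \<open>sqrt\<close>; cutting at the open orthant matches the range of the polar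
    coordinates.\<close>
  define f where "f l = indicator pos_orthant l * \<rho> l" for l
  have f_eq: "exp (- (v \<bullet> l)) * f l =
      exp (- (v \<bullet> l)) * (indicator pos_orthant l * Re (phase_integral l)) / ((2 * pi) ^ CARD('n) * det G)" for v l
    by (simp add: f_def \<rho>_def)
  interpret laplace_pair "distr M borel X" lborel f
  proof (rule laplace_pair.intro)
    show "integrable lborel f"
      using integrable_laplace_phase_integral[of 0]
      by (simp add: f_def[abs_def] \<rho>_def nonneg_orthant_def)
    show "AE x in distr M borel X. \<forall>i. 0 \<le> x $ i"
      using X_nonneg by (subst AE_distr_iff) (auto simp: nonneg_orthant_def)
    show "f x = 0" if "\<not> (\<forall>i. 0 \<le> x $ i)" for x
    proof -
      have "x \<notin> pos_orthant" using that by (auto simp: pos_orthant_def intro: less_imp_le)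
      then show ?thesis by (simp add: f_def)
    qed
    fix v :: "real^'n" assume "\<forall>i. 0 \<le> v $ i"
    then have v: "v \<in> nonneg_orthant" by (simp add: nonneg_orthant_def)
    \<comment> \<open>Positivity of the determinant makes \<open>powr (- 1)\<close> the
      reciprocal.\<close>
    have det: "0 < det (matrix_inv G + diag_mat v)"
      using v by (rule det_add_diag_mat_pos)
    have "(\<integral>x. exp (- (v \<bullet> x)) \<partial>distr M borel X) = (LINT \<omega>|M. exp (- (v \<bullet> X \<omega>)))"
      by (subst integral_distr) auto
    also have "\<dots> = 1 / (det (matrix_inv G + diag_mat v) * det G)"
      using perm v det detG
      by (simp add: permanental_vector_def det_matrix_inv_add_diag_mat[OF inv] powr_minus_divide)
    also have "\<dots> = (\<integral>x. exp (- (v \<bullet> x)) * f x \<partial>lborel)"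
      unfolding f_eq integral_divide_zero integral_laplace_phase_integral[OF v] by simp
    finally show "(\<integral>x. exp (- (v \<bullet> x)) \<partial>distr M borel X) = (\<integral>x. exp (- (v \<bullet> x)) * f x \<partial>lborel)" .
  next
    show "finite_measure (distr M borel X)"
      by (rule finite_measure_distr) measurable
  qed simp_all
  have nonneg: "0 \<le> \<rho> l" if l: "l \<in> nonneg_orthant" for l
  proof (rule ccontr)
    assume "\<not> 0 \<le> \<rho> l"
    \<comment> \<open>On \<open>S\<close> the function \<open>f\<close> is negative, yet its
      integral over \<open>S\<close> is the measure of \<open>S\<close> under the law. So
      \<open>S\<close> is Lebesgue null, which a nonempty open set cannot be.\<close>
    define S where "S = pos_orthant \<inter> {x. \<rho> x < 0}"
    have neg: "open {x. \<rho> x < 0}"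
      using cont by (intro open_Collect_less) auto
    then have S: "open S"
      unfolding S_def by (intro open_Int open_pos_orthant)
    \<comment> \<open>The point \<open>l\<close> may lie on the boundary, which \<open>S\<close>
      excludes. Moving along the all-ones vector enters the open orthant, and for small steps
      \<open>\<rho>\<close> stays negative.\<close>
    have "(\<lambda>k. l + (1 / real (Suc k)) *\<^sub>R (\<chi> i. 1)) \<longlonglongrightarrow> l + 0 *\<^sub>R (\<chi> i. 1)"
      by (intro tendsto_intros LIMSEQ_Suc lim_1_over_n)
    then have "(\<lambda>k. l + (1 / real (Suc k)) *\<^sub>R (\<chi> i. 1)) \<longlonglongrightarrow> l" by simp
    from topological_tendstoD[OF this neg] \<open>\<not> 0 \<le> \<rho> l\<close>
    obtain k where "\<rho> (l + (1 / real (Suc k)) *\<^sub>R (\<chi> i. 1)) < 0"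
      by (auto simp: eventually_sequentially)
    moreover have "l + (1 / real (Suc k)) *\<^sub>R (\<chi> i. 1) \<in> pos_orthant"
      using l by (auto simp: pos_orthant_def nonneg_orthant_def intro!: add_nonneg_pos)
    ultimately have "S \<noteq> {}" by (auto simp: S_def)
    have [measurable]: "S \<in> sets borel" using S by simp
    have le: "0 \<le> - (indicator S x * f x)" for x
      by (auto simp: S_def f_def indicator_def)
    have int: "integrable lborel (\<lambda>x. - (indicator S x * f x))"
      using integrable_real_mult_indicator[OF _ int_f, of S] by (simp add: mult.commute)
    have "(\<integral>x. - (indicator S x * f x) \<partial>lborel) = - measure (distr M borel X) S"
      by (simp add: measure_eq_integral)
    moreover have "0 \<le> (\<integral>x. - (indicator S x * f x) \<partial>lborel)"
      by (rule Bochner_Integration.integral_nonneg) (rule le)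
    ultimately have "(\<integral>x. - (indicator S x * f x) \<partial>lborel) = 0"
      using measure_nonneg[of "distr M borel X" S] by linarith
    then have "AE x in lborel. - (indicator S x * f x) = 0"
      using integral_nonneg_eq_0_iff_AE[OF int] le by simp
    then have "AE x in lborel. x \<notin> S"
      by eventually_elim (auto simp: S_def f_def)
    then have "S \<in> null_sets lborel"
      by (subst (asm) AE_iff_null_sets[symmetric]) auto
    then have "negligible S"
      by (simp add: negligible_iff_null_sets null_sets_completionI)
    then show False
      using open_not_negligible[OF S \<open>S \<noteq> {}\<close>] by simp
  qed
  then show "\<forall>l\<in>nonneg_orthant. 0 \<le> \<rho> l" by blast
  show "distributed M (restrict_space lborel nonneg_orthant) X (\<lambda>l. ennreal (\<rho> l))"
    unfolding distributed_def
  proof (intro conjI)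
    show "X \<in> measurable M (restrict_space lborel nonneg_orthant)"
      using X_nonneg by (intro measurable_restrict_space2) auto
    show "(\<lambda>l. ennreal (\<rho> l)) \<in> borel_measurable (restrict_space lborel nonneg_orthant)"
      by (intro measurable_restrict_space1) measurable
    show "distr M (restrict_space lborel nonneg_orthant) X =
        density (restrict_space lborel nonneg_orthant) (\<lambda>l. ennreal (\<rho> l))"
      (is "distr M ?R X = _")
    proof (rule measure_eqI)
      fix S assume "S \<in> sets (distr M ?R X)"
      then have SR: "S \<in> sets ?R" by simp
      then have S [measurable]: "S \<in> sets borel" and sub: "S \<subseteq> nonneg_orthant"
        by (auto simp: sets_restrict_space_iff)
      have XR: "X \<in> measurable M ?R"
        using X_nonneg by (intro measurable_restrict_space2) auto
      have "emeasure (distr M ?R X) S = emeasure (distr M borel X) S"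
        using XR SR by (simp add: emeasure_distr)
      also have "\<dots> = ennreal (\<integral>x. indicator S x * f x \<partial>lborel)"
        using finite_measure.emeasure_eq_measure[OF fin] by (simp add: measure_eq_integral)
      also have "\<dots> = (\<integral>\<^sup>+x. ennreal (indicator S x * f x) \<partial>lborel)"
      proof (rule nn_integral_eq_integral[symmetric])
        show "integrable lborel (\<lambda>x. indicator S x * f x)"
          using integrable_real_mult_indicator[OF _ int_f, of S] by (simp add: mult.commute)
        show "AE x in lborel. 0 \<le> indicator S x * f x"
          using sub nonneg by (auto simp: f_def indicator_def)
      qed
      \<comment> \<open>Within the orthant \<open>f\<close> and \<open>\<rho>\<close> can differ
        only on the boundary, which \<open>AE_pos_orthant\<close> discards.\<close>
      also have "\<dots> = (\<integral>\<^sup>+x. ennreal (\<rho> x) * indicator S x * indicator nonneg_orthant x \<partial>lborel)"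
      proof (rule nn_integral_cong_AE)
        show "AE x in lborel. ennreal (indicator S x * f x) = ennreal (\<rho> x) * indicator S x * indicator nonneg_orthant x"
          using AE_pos_orthant
          by eventually_elim (use sub in \<open>auto simp: f_def indicator_def\<close>)
      qed
      also have "\<dots> = (\<integral>\<^sup>+x. ennreal (\<rho> x) * indicator S x \<partial>?R)"
        by (subst nn_integral_restrict_space) auto
      also have "\<dots> = emeasure (density ?R (\<lambda>l. ennreal (\<rho> l))) S"
        using SR by (subst emeasure_density) (auto intro!: measurable_restrict_space1)
      finally show "emeasure (distr M ?R X) S = emeasure (density ?R (\<lambda>l. ennreal (\<rho> l))) S" .
    qed simp
  qed
qed

theorem lemma2p1:
  fixes G Q :: "real ^ 'n ^ 'n"
  assumes "positive_definite (symmetric_part G)"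
    and "Q = - matrix_inv G"
  shows "invertible G \<and>
    (\<forall>(M :: 'a measure) (X :: 'a \<Rightarrow> real ^ 'n). permanental_vector 1 G M X \<longrightarrow>
      (\<exists>\<rho> :: real ^ 'n \<Rightarrow> real.
        (\<forall>l\<in>nonneg_orthant. 0 \<le> \<rho> l) \<and>
        distributed M (restrict_space lborel nonneg_orthant) X (\<lambda>l. ennreal (\<rho> l)) \<and>
        (\<forall>l\<in>nonneg_orthant.
          complex_of_real (\<rho> l) =
            (LINT \<theta>:{\<theta> :: real ^ 'n. \<forall>i. 0 < \<theta> $ i \<and> \<theta> $ i < 2 * pi}|lborel.
              complex_of_real (1 / ((2 * pi) ^ CARD('n) * det G)) *
              exp (\<Sum>i\<in>UNIV. \<Sum>j\<in>UNIV.
                complex_of_real (Q $ i $ j * sqrt (l $ i * l $ j)) *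
                exp (\<i> * complex_of_real (\<theta> $ i - \<theta> $ j)))))))"
proof (intro conjI allI impI)
  have posG: "0 < x \<bullet> (G *v x)" if "x \<noteq> 0" for x
    using assms(1) that by (simp add: positive_definite_def inner_symmetric_part)
  then show "invertible G"
    using det_pos_of_positive_form[of G] by (simp add: invertible_det_nz)
  interpret positive_kernel "matrix_inv G"
    by unfold_locales (rule positive_form_matrix_inv[OF posG])
  let ?c = "1 / ((2 * pi) ^ CARD('n) * det G)"
  define \<rho> where "\<rho> l = Re (phase_integral l) / ((2 * pi) ^ CARD('n) * det G)" for l
  fix M :: "'a measure" and X :: "'a \<Rightarrow> real ^ 'n"
  assume perm: "permanental_vector 1 G M X"
  have "complex_of_real (\<rho> l) =
      (LINT \<theta>:{\<theta> :: real ^ 'n. \<forall>i. 0 < \<theta> $ i \<and> \<theta> $ i < 2 * pi}|lborel.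
        complex_of_real ?c * exp (\<Sum>i\<in>UNIV. \<Sum>j\<in>UNIV.
          complex_of_real (Q $ i $ j * sqrt (l $ i * l $ j)) *
          exp (\<i> * complex_of_real (\<theta> $ i - \<theta> $ j))))" if l: "l \<in> nonneg_orthant" for l
  proof -
    have e: "(\<Sum>i\<in>UNIV. \<Sum>j\<in>UNIV. complex_of_real (Q $ i $ j * sqrt (l $ i * l $ j)) *
          exp (\<i> * complex_of_real (\<theta> $ i - \<theta> $ j))) = - herm (matrix_inv G) (polar_vec (l, \<theta>))" for \<theta>
      by (simp add: herm_polar_vec[OF l] assms(2) sum_negf)
    \<comment> \<open>\<open>phase_integral_real\<close> turns the real part used to define
      \<open>\<rho>\<close> back into the full complex integral.\<close>
    have "complex_of_real (\<rho> l) = complex_of_real ?c * phase_integral l"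
      by (subst phase_integral_real[symmetric]) (simp add: \<rho>_def)
    also have "\<dots> = (\<integral>\<theta>. complex_of_real ?c * (indicator angle_box \<theta> *\<^sub>R exp (- herm (matrix_inv G) (polar_vec (l, \<theta>)))) \<partial>lborel)"
      unfolding phase_integral_def by (rule integral_mult_right_zero[symmetric])
    finally show ?thesis
      unfolding e set_lebesgue_integral_def angle_box_def[symmetric] by (simp only: mult_scaleR_right)
  qed
  then show "\<exists>\<rho>. (\<forall>l\<in>nonneg_orthant. 0 \<le> \<rho> l) \<and>
      distributed M (restrict_space lborel nonneg_orthant) X (\<lambda>l. ennreal (\<rho> l)) \<and>
      (\<forall>l\<in>nonneg_orthant. complex_of_real (\<rho> l) =
        (LINT \<theta>:{\<theta> :: real ^ 'n. \<forall>i. 0 < \<theta> $ i \<and> \<theta> $ i < 2 * pi}|lborel.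
          complex_of_real ?c * exp (\<Sum>i\<in>UNIV. \<Sum>j\<in>UNIV.
            complex_of_real (Q $ i $ j * sqrt (l $ i * l $ j)) *
            exp (\<i> * complex_of_real (\<theta> $ i - \<theta> $ j)))))"
    using permanental_density[OF posG perm \<rho>_def] by (intro exI[of _ \<rho>]) blast
qed

end
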